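(* Let $f\colon(X,x)\to(Y,y)$ be a map between pointed cubical Kan complexes and let $(A,a)$ be the fiber of $f$, i.e. the pullback $A$ of $f\colon X\to Y$ along $y\colon\square^0\to Y$, with projection $i\colon A\to X$ and base point $a$ such that $i(a)=x$. If $f$ is a Kan fibration, then there is a long exact sequence $$\cdots\to\pi_n(A,a)\xrightarrow{\pi_n i}\pi_n(X,x)\xrightarrow{\pi_n f}\pi_n(Y,y)\to\pi_{n-1}(A,a)\xrightarrow{\pi_{n-1}i}\pi_{n-1}(X,x)\xrightarrow{\pi_{n-1}f}\pi_{n-1}(Y,y)\to\cdots$$ $$\cdots\to\pi_1(A,a)\xrightarrow{\pi_1 i}\pi_1(X,x)\xrightarrow{\pi_1 f}\pi_1(Y,y)\to\pi_0A\xrightarrow{\pi_0 i}\pi_0X\xrightarrow{\pi_0 f}\pi_0Y$$ of groups, and of pointed sets at the $\pi_0$ end.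
   Context: Cubes: $\square$ is the category whose objects are the posets $[1]^n=\{0\le 1\}^n$, $n\ge 0$, with morphisms generated under composition (inside posets) by the faces $\partial_{i,\varepsilon}\colon [1]^{n-1}\to[1]^n$ inserting $\varepsilon\in\{0,1\}$ as $i$-th coordinate, the degeneracies $\sigma_i\colon[1]^n\to[1]^{n-1}$ deleting the $i$-th coordinate, and the connections $\gamma_{i,0},\gamma_{i,1}\colon[1]^n\to[1]^{n-1}$ ($1\le i\le n-1$) replacing $x_i,x_{i+1}$ by their maximum, resp. minimum. A cubical set is a functor $\square^{op}\to\mathsf{Set}$; operators act on the right. $\square^n$ is the representable at $[1]^n$. The open box $\sqcap^n_{i,\varepsilon}\subseteq\square^n$ is the union of the images of all faces $\partial_{j,\eta}$ with $(j,\eta)\ne(i,\varepsilon)$. The geometric product $\otimes$ is the left Kan extension of $[1]^m\otimes[1]^n=[1]^{m+n}$, and $\hom_R(X,-)$ is the right adjoint of $X\otimes -$. A Kan fibration is a cubical map with the right lifting property against all open box inclusions $\sqcap^n_{i,\varepsilon}\hookrightarrow\square^n$; a Kan complex is a cubical set $X$ such that $X\to\square^0$ is a Kan fibration. Cubical homotopy groups of a pointed Kan complex $(X,x)$: $\Omega(X,x)$ is the pullback of $(x,x)\colon\square^0\to X\times X$ along $(\partial_{1,0}^*,\partial_{1,1}^* )\colon\hom_R(\square^1,X)\to X\times X$, pointed at $x\sigma_1$ (so a $k$-cube of $\Omega(X,x)$ is a $(k+1)$-cube of $X$ whose $\partial_{1,0}$- and $\partial_{1,1}$-faces are degenerate at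 $x$); $\Omega^0(X,x)=(X,x)$ and $\Omega^n(X,x)=\Omega(\Omega^{n-1}(X,x))$. $\pi_0(X)$ is the colimit of $X\colon\square^{op}\to\mathsf{Set}$ (pointed at the class of $x$) and $\pi_n(X,x)=\pi_0(\Omega^n(X,x))$. Group structure on $\pi_1(X,x)$: for $1$-cubes $f,g$ with both end-points $x$, $[f][g]=[s\partial_{2,0}]$ for any $2$-cube $s$ with $s\partial_{1,0}=f$, $s\partial_{2,1}=g$, $s\partial_{1,1}=x\sigma_1$; for $n\ge1$, $\pi_n(X,x)=\pi_1(\Omega^{n-1}(X,x))$ carries the resulting group structure. *)

theory Defs
  imports "HOL-Algebra.Coset"
begin

section \<open>The cube category\<close>

text \<open>The object \<open>[1]^n\<close> is the set \<open>vertices n\<close> of Boolean lists of length \<open>n\<close>, with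
  \<open>False\<close> for 0 and \<open>True\<close> for 1. A morphism \<open>[1]^m \<rightarrow> [1]^n\<close> is a function that is extensional on
  \<open>vertices m\<close>, so equality of morphisms is equality in HOL. Coordinates are numbered from 1.\<close>

definition vertices :: "nat \<Rightarrow> bool list set" where
  "vertices n = {v. length v = n}"

type_synonym cmor = "bool list \<Rightarrow> bool list"

definition idm :: "nat \<Rightarrow> cmor" where
  "idm n = restrict (\<lambda>v. v) (vertices n)"

text \<open>\<open>face n i \<epsilon>\<close> is the face with \<^emph>\<open>domain\<close> \<open>[1]^n\<close> and codomain \<open>[1]^(n+1)\<close>.\<close>

definition face :: "nat \<Rightarrow> nat \<Rightarrow> bool \<Rightarrow> cmor" where
  "face n i \<epsilon> = restrict (\<lambda>v. take (i - 1) v @ [\<epsilon>] @ drop (i - 1) v) (vertices n)"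

text \<open>\<open>degen n i\<close> and \<open>conn n i \<epsilon>\<close> have \<^emph>\<open>codomain\<close> \<open>[1]^n\<close> and domain \<open>[1]^(n+1)\<close>.\<close>

definition degen :: "nat \<Rightarrow> nat \<Rightarrow> cmor" where
  "degen n i = restrict (\<lambda>v. take (i - 1) v @ drop i v) (vertices (Suc n))"

definition conn :: "nat \<Rightarrow> nat \<Rightarrow> bool \<Rightarrow> cmor" where
  "conn n i \<epsilon> = restrict
     (\<lambda>v. take (i - 1) v
          @ [if \<epsilon> then min (v ! (i - 1)) (v ! i) else max (v ! (i - 1)) (v ! i)]
          @ drop (i + 1) v)
     (vertices (Suc n))"

inductive cube_mor :: "nat \<Rightarrow> nat \<Rightarrow> cmor \<Rightarrow> bool" where
  cube_mor_id: "cube_mor n n (idm n)"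
| cube_mor_comp: "cube_mor l m \<phi> \<Longrightarrow> cube_mor m n \<psi> \<Longrightarrow> cube_mor l n (compose (vertices l) \<psi> \<phi>)"
| cube_mor_face: "1 \<le> i \<Longrightarrow> i \<le> n + 1 \<Longrightarrow> cube_mor n (Suc n) (face n i \<epsilon>)"
| cube_mor_degen: "1 \<le> i \<Longrightarrow> i \<le> n + 1 \<Longrightarrow> cube_mor (Suc n) n (degen n i)"
| cube_mor_conn: "1 \<le> i \<Longrightarrow> i \<le> n \<Longrightarrow> cube_mor (Suc n) n (conn n i \<epsilon>)"

text \<open>The unique morphism \<open>[1]^k \<rightarrow> [1]^0\<close>.\<close>

definition bang :: "nat \<Rightarrow> cmor" where
  "bang k = restrict (\<lambda>v. []) (vertices k)"

text \<open>The morphism \<open>[1]^1 \<otimes> \<phi> : [1]^(1+m) \<rightarrow> [1]^(1+n)\<close> for \<open>\<phi> : [1]^m \<rightarrow> [1]^n\<close>.\<close>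

definition one_tensor :: "nat \<Rightarrow> cmor \<Rightarrow> cmor" where
  "one_tensor m \<phi> = restrict (\<lambda>v. take 1 v @ \<phi> (drop 1 v)) (vertices (Suc m))"


section \<open>Cubical sets\<close>

text \<open>\<open>act X m n \<phi> z\<close> is \<open>z\<phi>\<close> for \<open>\<phi> : [1]^m \<rightarrow> [1]^n\<close> and an \<open>n\<close>-cube \<open>z\<close>. The values of \<open>act\<close>
  elsewhere are irrelevant.\<close>

record 'a cset =
  cells :: "nat \<Rightarrow> 'a set"
  act :: "nat \<Rightarrow> nat \<Rightarrow> cmor \<Rightarrow> 'a \<Rightarrow> 'a"

definition cubical_set :: "'a cset \<Rightarrow> bool" where
  "cubical_set X \<longleftrightarrow>
     (\<forall>m n \<phi> z. cube_mor m n \<phi> \<longrightarrow> z \<in> cells X n \<longrightarrow> act X m n \<phi> z \<in> cells X m) \<and>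
     (\<forall>n z. z \<in> cells X n \<longrightarrow> act X n n (idm n) z = z) \<and>
     (\<forall>l m n \<phi> \<psi> z. cube_mor l m \<phi> \<longrightarrow> cube_mor m n \<psi> \<longrightarrow> z \<in> cells X n \<longrightarrow>
        act X l n (compose (vertices l) \<psi> \<phi>) z = act X l m \<phi> (act X m n \<psi> z))"

definition cubical_map :: "'a cset \<Rightarrow> 'b cset \<Rightarrow> (nat \<Rightarrow> 'a \<Rightarrow> 'b) \<Rightarrow> bool" where
  "cubical_map X Y f \<longleftrightarrow>
     (\<forall>n z. z \<in> cells X n \<longrightarrow> f n z \<in> cells Y n) \<and>
     (\<forall>m n \<phi> z. cube_mor m n \<phi> \<longrightarrow> z \<in> cells X n \<longrightarrow> f m (act X m n \<phi> z) = act Y m n \<phi> (f n z))"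

definition cube :: "nat \<Rightarrow> cmor cset" where
  "cube n = \<lparr>cells = (\<lambda>k. {\<phi>. cube_mor k n \<phi>}),
             act = (\<lambda>m k \<phi> \<psi>. compose (vertices m) \<psi> \<phi>)\<rparr>"

definition open_box :: "nat \<Rightarrow> nat \<Rightarrow> bool \<Rightarrow> cmor cset" where
  "open_box n i \<epsilon> = \<lparr>cells = (\<lambda>k. {compose (vertices k) (face (n - 1) j \<eta>) \<psi> | j \<eta> \<psi>.
                                  1 \<le> j \<and> j \<le> n \<and> (j, \<eta>) \<noteq> (i, \<epsilon>) \<and> cube_mor k (n - 1) \<psi>}),
                     act = act (cube n)\<rparr>"

definition terminal_map :: "nat \<Rightarrow> 'a \<Rightarrow> cmor" where
  "terminal_map k z = bang k"

text \<open>The map \<open>cube 0 \<rightarrow> X\<close> that corresponds to a vertex \<open>x\<close> by the Yoneda lemma.\<close>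

definition point :: "'a cset \<Rightarrow> 'a \<Rightarrow> nat \<Rightarrow> cmor \<Rightarrow> 'a" where
  "point X x k \<phi> = act X k 0 \<phi> x"

definition prod_cset :: "'a cset \<Rightarrow> 'b cset \<Rightarrow> ('a \<times> 'b) cset" where
  "prod_cset X Y = \<lparr>cells = (\<lambda>n. cells X n \<times> cells Y n),
                    act = (\<lambda>m n \<phi> (z, w). (act X m n \<phi> z, act Y m n \<phi> w))\<rparr>"

text \<open>\<open>W\<close> with \<open>p : W \<rightarrow> X\<close> and \<open>q : W \<rightarrow> Z\<close> is a pullback of \<open>f : X \<rightarrow> Y\<close> along \<open>g : Z \<rightarrow> Y\<close>.
  Limits of cubical sets are limits of sets in each dimension.\<close>

definition is_pullback ::
  "'w cset \<Rightarrow> 'a cset \<Rightarrow> 'z cset \<Rightarrow> 'b cset \<Rightarrow> (nat \<Rightarrow> 'w \<Rightarrow> 'a) \<Rightarrow> (nat \<Rightarrow> 'w \<Rightarrow> 'z) \<Rightarrow>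
   (nat \<Rightarrow> 'a \<Rightarrow> 'b) \<Rightarrow> (nat \<Rightarrow> 'z \<Rightarrow> 'b) \<Rightarrow> bool" where
  "is_pullback W X Z Y p q f g \<longleftrightarrow>
     cubical_set W \<and> cubical_map W X p \<and> cubical_map W Z q \<and>
     (\<forall>k. \<forall>w\<in>cells W k. f k (p k w) = g k (q k w)) \<and>
     (\<forall>k. \<forall>z\<in>cells X k. \<forall>t\<in>cells Z k. f k z = g k t \<longrightarrow>
        (\<exists>!w. w \<in> cells W k \<and> p k w = z \<and> q k w = t))"


section \<open>Kan fibrations\<close>

definition has_rlp ::
  "'s cset \<Rightarrow> 't cset \<Rightarrow> (nat \<Rightarrow> 's \<Rightarrow> 't) \<Rightarrow> 'a cset \<Rightarrow> 'b cset \<Rightarrow> (nat \<Rightarrow> 'a \<Rightarrow> 'b) \<Rightarrow> bool" where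
  "has_rlp S T j X Y p \<longleftrightarrow>
     (\<forall>u v. cubical_map S X u \<longrightarrow> cubical_map T Y v \<longrightarrow>
        (\<forall>k. \<forall>s\<in>cells S k. p k (u k s) = v k (j k s)) \<longrightarrow>
        (\<exists>w. cubical_map T X w \<and>
             (\<forall>k. \<forall>s\<in>cells S k. w k (j k s) = u k s) \<and>
             (\<forall>k. \<forall>t\<in>cells T k. p k (w k t) = v k t)))"

definition kan_fibration :: "'a cset \<Rightarrow> 'b cset \<Rightarrow> (nat \<Rightarrow> 'a \<Rightarrow> 'b) \<Rightarrow> bool" where
  "kan_fibration X Y p \<longleftrightarrow> cubical_map X Y p \<and>
     (\<forall>n i \<epsilon>. 1 \<le> i \<longrightarrow> i \<le> n \<longrightarrow> has_rlp (open_box n i \<epsilon>) (cube n) (\<lambda>k \<phi>. \<phi>) X Y p)"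

definition kan_complex :: "'a cset \<Rightarrow> bool" where
  "kan_complex X \<longleftrightarrow> cubical_set X \<and> kan_fibration X (cube 0) terminal_map"


section \<open>Loop objects\<close>

text \<open>The cubical set \<open>hom\<^sub>R(\<box>\<^sup>1, X)\<close>. By adjunction and the Yoneda lemma its \<open>k\<close>-cubes are the maps
  \<open>\<box>\<^sup>1 \<otimes> \<box>\<^sup>k = \<box>\<^sup>1\<^sup>+\<^sup>k \<rightarrow> X\<close>, i.e. the \<open>(1+k)\<close>-cubes of \<open>X\<close>, and \<open>\<phi>\<close> acts through \<open>[1]^1 \<otimes> \<phi>\<close>.\<close>

definition path_cset :: "'a cset \<Rightarrow> 'a cset" where
  "path_cset X = \<lparr>cells = (\<lambda>k. cells X (Suc k)),
                  act = (\<lambda>m n \<phi>. act X (Suc m) (Suc n) (one_tensor m \<phi>))\<rparr>"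

definition path_ends :: "'a cset \<Rightarrow> nat \<Rightarrow> 'a \<Rightarrow> 'a \<times> 'a" where
  "path_ends X k z = (act X k (Suc k) (face k 1 False) z, act X k (Suc k) (face k 1 True) z)"

text \<open>The pullback of \<open>f : X \<rightarrow> Y\<close> along \<open>y : \<box>\<^sup>0 \<rightarrow> Y\<close>, realised as a cubical subset of \<open>X\<close>; this
  is possible because \<open>\<box>\<^sup>0\<close> has exactly one cube in each dimension.\<close>

definition fiber :: "'a cset \<Rightarrow> 'b cset \<Rightarrow> (nat \<Rightarrow> 'a \<Rightarrow> 'b) \<Rightarrow> 'b \<Rightarrow> 'a cset" where
  "fiber X Y f y = \<lparr>cells = (\<lambda>k. {z \<in> cells X k. f k z = point Y y k (bang k)}), act = act X\<rparr>"

text \<open>A pointed cubical set is a pair of a cubical set and a vertex of it.\<close>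

definition loop :: "'a cset \<times> 'a \<Rightarrow> 'a cset \<times> 'a" where
  "loop P = (case P of (X, x) \<Rightarrow>
     (fiber (path_cset X) (prod_cset X X) (path_ends X) (x, x), act X 1 0 (degen 0 1) x))"

text \<open>The restriction to loop objects of the map of path objects induced by \<open>f\<close>.\<close>

definition loop_map :: "(nat \<Rightarrow> 'a \<Rightarrow> 'b) \<Rightarrow> nat \<Rightarrow> 'a \<Rightarrow> 'b" where
  "loop_map f k = f (Suc k)"


section \<open>Homotopy groups\<close>

text \<open>The colimit of \<open>X\<close>: the disjoint union of the sets of \<open>n\<close>-cubes modulo the equivalence
  relation generated by \<open>z \<sim> z\<phi>\<close>.\<close>

definition cube_step :: "'a cset \<Rightarrow> ((nat \<times> 'a) \<times> (nat \<times> 'a)) set" where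
  "cube_step X = {((n, z), (m, act X m n \<phi> z)) | m n \<phi> z. cube_mor m n \<phi> \<and> z \<in> cells X n}"

definition cube_equiv :: "'a cset \<Rightarrow> ((nat \<times> 'a) \<times> (nat \<times> 'a)) set" where
  "cube_equiv X = (cube_step X \<union> (cube_step X)\<inverse>)\<^sup>*"

definition pi0 :: "'a cset \<Rightarrow> (nat \<times> 'a) set set" where
  "pi0 X = (SIGMA n:UNIV. cells X n) // cube_equiv X"

definition pi0_class :: "'a cset \<Rightarrow> nat \<Rightarrow> 'a \<Rightarrow> (nat \<times> 'a) set" where
  "pi0_class X n z = cube_equiv X `` {(n, z)}"

text \<open>The map \<open>[z] \<mapsto> [f z]\<close>: the image of a class is saturated to a class of the codomain \<open>Y\<close>.\<close>

definition pi0_map :: "'b cset \<Rightarrow> (nat \<Rightarrow> 'a \<Rightarrow> 'b) \<Rightarrow> (nat \<times> 'a) set \<Rightarrow> (nat \<times> 'b) set" where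
  "pi0_map Y f c = cube_equiv Y `` ((\<lambda>(n, z). (n, f n z)) ` c)"

definition pi_set :: "nat \<Rightarrow> 'a cset \<times> 'a \<Rightarrow> (nat \<times> 'a) set set" where
  "pi_set n P = pi0 (fst ((loop ^^ n) P))"

definition pi_base :: "nat \<Rightarrow> 'a cset \<times> 'a \<Rightarrow> (nat \<times> 'a) set" where
  "pi_base n P = pi0_class (fst ((loop ^^ n) P)) 0 (snd ((loop ^^ n) P))"

text \<open>The map \<open>\<pi>\<^sub>n P \<rightarrow> \<pi>\<^sub>n Q\<close> induced by \<open>f\<close>; only the codomain \<open>Q\<close> is an explicit argument.\<close>

definition pi_map ::
  "nat \<Rightarrow> 'b cset \<times> 'b \<Rightarrow> (nat \<Rightarrow> 'a \<Rightarrow> 'b) \<Rightarrow> (nat \<times> 'a) set \<Rightarrow> (nat \<times> 'b) set" where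
  "pi_map n Q f = pi0_map (fst ((loop ^^ n) Q)) ((loop_map ^^ n) f)"

text \<open>The elements \<open>a\<close>, \<open>b\<close> and the product are classes of vertices of the loop object, i.e. of
  1-cubes of \<open>X\<close> with both end points at \<open>x\<close>. In a Kan complex the product does not depend on the
  choice of \<open>f\<close>, \<open>g\<close> and \<open>s\<close>.\<close>

definition pi1_mult ::
  "'a cset \<times> 'a \<Rightarrow> (nat \<times> 'a) set \<Rightarrow> (nat \<times> 'a) set \<Rightarrow> (nat \<times> 'a) set" where
  "pi1_mult P a b = (let X = fst P; x = snd P; L = fst (loop P) in
     THE c. \<exists>f g s. f \<in> cells L 0 \<and> g \<in> cells L 0 \<and>
       a = pi0_class L 0 f \<and> b = pi0_class L 0 g \<and>
       s \<in> cells X 2 \<and>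
       act X 1 2 (face 1 1 False) s = f \<and>
       act X 1 2 (face 1 2 True) s = g \<and>
       act X 1 2 (face 1 1 True) s = act X 1 0 (degen 0 1) x \<and>
       c = pi0_class L 0 (act X 1 2 (face 1 2 False) s))"

definition pi1_group :: "'a cset \<times> 'a \<Rightarrow> (nat \<times> 'a) set monoid" where
  "pi1_group P = \<lparr>carrier = pi_set 1 P, mult = pi1_mult P, one = pi_base 1 P\<rparr>"

text \<open>Meaningful for \<open>n \<ge> 1\<close> only.\<close>

definition pi_group :: "nat \<Rightarrow> 'a cset \<times> 'a \<Rightarrow> (nat \<times> 'a) set monoid" where
  "pi_group n P = pi1_group ((loop ^^ (n - 1)) P)"

lemma carrier_pi_group: "n \<ge> 1 \<Longrightarrow> carrier (pi_group n P) = pi_set n P"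
  by (cases n) (simp_all add: pi_group_def pi1_group_def pi_set_def)

lemma one_pi_group: "n \<ge> 1 \<Longrightarrow> \<one>\<^bsub>pi_group n P\<^esub> = pi_base n P"
  by (cases n) (simp_all add: pi_group_def pi1_group_def pi_base_def)

definition pointed_map :: "'a set \<Rightarrow> 'a \<Rightarrow> 'b set \<Rightarrow> 'b \<Rightarrow> ('a \<Rightarrow> 'b) \<Rightarrow> bool" where
  "pointed_map S s T t g \<longleftrightarrow> g \<in> S \<rightarrow> T \<and> g s = t"

text \<open>Exactness of \<open>R \<rightarrow> S \<rightarrow> T\<close> at \<open>S\<close> for pointed sets, with \<open>t\<close> the base point of \<open>T\<close>.
  For groups, pointed at the identity, this is the usual equality of image and kernel.\<close>

definition exact_at :: "'a set \<Rightarrow> ('a \<Rightarrow> 'b) \<Rightarrow> 'b set \<Rightarrow> ('b \<Rightarrow> 'c) \<Rightarrow> 'c \<Rightarrow> bool" where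
  "exact_at R g S h t \<longleftrightarrow> g ` R = {s \<in> S. h s = t}"

end

(*
  Every homotopy group is a group of path components of an iterated loop object, and looping
  preserves "Kan fibration together with its fiber". It therefore suffices to prove exactness of
  pi_1 X -> pi_1 Y -> pi_0 A -> pi_0 X -> pi_0 Y for an arbitrary fibration: the general case is
  this one for the n-fold loop objects. The connecting map sends a loop p in Y to the start point of
  a lift of p that ends at x; exactness and independence of choices come from lifting squares.
  Well-definedness and associativity of the product on pi_1 come from filling 3-dimensional boxes.
  The connecting map on pi_(n+2) Y is a homomorphism by lifting two 3-dimensional boxes.

  The right lifting property is used only in the form "a compatible family of faces extends to a
  cube". For this, a family of faces has to determine a map on the open box; it is well defined
  because two faces of a cube meet in a common face, with no normal form for cube maps needed.
*)
theory Submission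
  imports Defs
begin

subsection \<open>Cubical identities\<close>

text \<open>Equality in the colimit \<open>pi0\<close> means a zigzag through cubes of all
  dimensions. For a Kan complex it shrinks to a single edge between vertices: every cube is traded
  for its vertex at 0, and a structure map moves that vertex only within one cube. This is what
  makes squares and 3-cubes sufficient later on. The homomorphism property takes two boxes because
  of a clash of directions. Looping puts its coordinate first, so an element of
  \<open>pi_2 Y\<close> is a square with constant boundary, and the product runs along its second
  coordinate. The connecting map lifts along this same coordinate and leaves a loop in
  \<open>A\<close> along the first one, where the product of \<open>pi_1 A\<close> lives. The first
  box moves the product from \<open>Y\<close> up to \<open>X\<close>; the second lies over the cube
  \<open>P(max(x1, x2), x3)\<close>, which folds the two directions together, and its open face is a
  product square of \<open>A\<close>. This is the only cube built with a connection.\<close>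

definition ins :: "nat \<Rightarrow> bool \<Rightarrow> bool list \<Rightarrow> bool list" where
  "ins i b v = take i v @ b # drop i v"

lemma length_ins [simp]: "length (ins i b v) = Suc (length v)"
  by (simp add: ins_def)

lemma ins_0 [simp]: "ins 0 b v = b # v"
  by (simp add: ins_def)

lemma ins_Suc_Cons [simp]: "ins (Suc i) b (c # v) = c # ins i b v"
  by (simp add: ins_def)

lemma nth_ins: "i \<le> length v \<Longrightarrow> ins i b v ! i = b"
  by (simp add: ins_def nth_append)

lemma ins_inj: "ins i b v = ins i c w \<Longrightarrow> i \<le> length v \<Longrightarrow> length v = length w \<Longrightarrow> b = c \<and> v = w"
proof (induction i arbitrary: v w)
  case (Suc i)
  from Suc.prems(2,3) obtain p v' q w' where "v = p # v'" "w = q # w'"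
    by (cases v; cases w) auto
  with Suc.IH[of v' w'] Suc.prems show ?case by simp
qed simp

text \<open>The combinatorial core of \<open>face_face\<close>: inserting at \<open>k\<close> moves
  every position from \<open>k\<close> on one place to the right.\<close>

lemma ins_ins: "k \<le> j \<Longrightarrow> j \<le> length v \<Longrightarrow> ins (Suc j) b (ins k c v) = ins k c (ins j b v)"
proof (induction k arbitrary: j v)
  case (Suc k)
  from Suc.prems obtain j' p v' where "j = Suc j'" "v = p # v'"
    by (cases j; cases v) auto
  with Suc.IH[of j' v'] Suc.prems show ?case by simp
qed simp

lemma ins_delete: "i < length v \<Longrightarrow> v ! i = b \<Longrightarrow> ins i b (take i v @ drop (Suc i) v) = v"
  using id_take_nth_drop[of i v] by (simp add: ins_def)

lemma nth_ins_less: "k < j \<Longrightarrow> j \<le> length v \<Longrightarrow> ins j b v ! k = v ! k"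
  by (simp add: ins_def nth_append)

text \<open>Directions count from 1 and list positions from 0, hence the shift.\<close>

lemma face_app: "length v = n \<Longrightarrow> face n i b v = ins (i - 1) b v"
  by (simp add: face_def vertices_def ins_def)

lemma degen_app: "length v = Suc n \<Longrightarrow> degen n i v = take (i - 1) v @ drop i v"
  by (simp add: degen_def vertices_def)

lemma conn_app: "length v = Suc n \<Longrightarrow> conn n i b v = take (i - 1) v
    @ (if b then min (v ! (i - 1)) (v ! i) else max (v ! (i - 1)) (v ! i)) # drop (i + 1) v"
  by (simp add: conn_def vertices_def)

lemma idm_app: "length v = n \<Longrightarrow> idm n v = v"
  by (simp add: idm_def vertices_def)

lemma bang_app [simp]: "length v = n \<Longrightarrow> bang n v = []"
  by (simp add: bang_def vertices_def)

lemma bang_extensional [simp]: "bang n \<in> extensional (vertices n)"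
  unfolding bang_def by (rule restrict_extensional)

lemma face_extensional [simp]: "face n i b \<in> extensional (vertices n)"
  unfolding face_def by (rule restrict_extensional)

lemma degen_extensional [simp]: "degen n i \<in> extensional (vertices (Suc n))"
  unfolding degen_def by (rule restrict_extensional)

lemma conn_extensional [simp]: "conn n i b \<in> extensional (vertices (Suc n))"
  unfolding conn_def by (rule restrict_extensional)

lemma idm_extensional [simp]: "idm n \<in> extensional (vertices n)"
  unfolding idm_def by (rule restrict_extensional)

lemma cube_mor_extensional: "cube_mor m n \<phi> \<Longrightarrow> \<phi> \<in> extensional (vertices m)"
  by (induction rule: cube_mor.induct)
    (simp_all only: idm_def face_def degen_def conn_def restrict_extensional compose_extensional)

lemma cube_mor_length: "cube_mor m n \<phi> \<Longrightarrow> length v = m \<Longrightarrow> length (\<phi> v) = n"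
  by (induction arbitrary: v rule: cube_mor.induct)
    (auto simp: idm_def face_def degen_def conn_def vertices_def compose_def)

lemma vertices_ext:
  assumes "\<phi> \<in> extensional (vertices m)" "\<psi> \<in> extensional (vertices m)"
    and "\<And>v. length v = m \<Longrightarrow> \<phi> v = \<psi> v"
  shows "\<phi> = \<psi>"
  using assms by (intro extensionalityI) (auto simp: vertices_def)

lemma compose_app: "length v = l \<Longrightarrow> compose (vertices l) \<psi> \<phi> v = \<psi> (\<phi> v)"
  by (simp add: compose_def vertices_def)

text \<open>The restriction to vertices does no harm, since \<open>\<phi>\<close> takes vertices of
  length \<open>k\<close> to vertices of length \<open>l\<close>.\<close>

lemma compose_assoc_cube:
  assumes "cube_mor k l \<phi>"
  shows "compose (vertices k) \<chi> (compose (vertices k) \<psi> \<phi>)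
       = compose (vertices k) (compose (vertices l) \<chi> \<psi>) \<phi>"
  by (rule vertices_ext[where m = k]) (use cube_mor_length[OF assms] in \<open>auto simp: compose_app\<close>)

lemma cube_mor_bang: "cube_mor k 0 (bang k)"
proof (induction k)
  case 0
  have "bang 0 = idm 0"
    by (rule vertices_ext[where m = "0"]) (auto simp: idm_app)
  then show ?case using cube_mor_id by simp
next
  case (Suc k)
  have "bang (Suc k) = compose (vertices (Suc k)) (bang k) (degen k 1)"
    by (rule vertices_ext[where m = "Suc k"]) (auto simp: compose_app degen_app)
  then show ?case
    using cube_mor_comp[OF cube_mor_degen[of 1 k] Suc] by simp
qed

lemma cube_mor_bang_unique: "cube_mor k 0 \<phi> \<Longrightarrow> \<phi> = bang k"
  by (rule vertices_ext[where m = k])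
    (auto dest: cube_mor_extensional cube_mor_length)

lemma bang_compose: "cube_mor l m \<phi> \<Longrightarrow> compose (vertices l) (bang m) \<phi> = bang l"
  by (rule vertices_ext[where m = "l"]) (auto simp: compose_app cube_mor_length)

lemma face_face:
  assumes "1 \<le> k" "k < j" "j \<le> Suc (Suc n)"
  shows "compose (vertices n) (face (Suc n) j b) (face n k c)
       = compose (vertices n) (face (Suc n) k c) (face n (j - 1) b)"
proof (rule vertices_ext[where m = "n"])
  fix v :: "bool list" assume "length v = n"
  then show "compose (vertices n) (face (Suc n) j b) (face n k c) v
    = compose (vertices n) (face (Suc n) k c) (face n (j - 1) b) v"
    \<comment> \<open>With positions from 0, the face \<open>j - 1\<close> inserts at
      \<open>j - 2\<close>; \<open>k < j\<close> gives \<open>k - 1 \<le> j - 2\<close>.\<close>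
    using assms ins_ins[of "k - 1" "j - 2" v b c]
    by (simp add: compose_app face_app Suc_diff_Suc numeral_2_eq_2)
qed auto

section \<open>Tensoring with the interval\<close>

lemma one_tensor_app: "length v = Suc m \<Longrightarrow> one_tensor m \<phi> v = hd v # \<phi> (tl v)"
  by (cases v) (auto simp: one_tensor_def vertices_def)

lemma one_tensor_extensional [simp]: "one_tensor m \<phi> \<in> extensional (vertices (Suc m))"
  unfolding one_tensor_def by (rule restrict_extensional)

lemma one_tensor_compose:
  assumes "cube_mor l m \<phi>"
  shows "one_tensor l (compose (vertices l) \<psi> \<phi>)
       = compose (vertices (Suc l)) (one_tensor m \<psi>) (one_tensor l \<phi>)"
  by (rule vertices_ext[where m = "Suc l"]) (auto simp: compose_app one_tensor_app cube_mor_length[OF assms])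

lemma one_tensor_idm: "one_tensor n (idm n) = idm (Suc n)"
  by (rule vertices_ext[where m = "Suc n"]) (auto simp: one_tensor_app idm_app length_Suc_conv)

lemma one_tensor_face:
  "1 \<le> i \<Longrightarrow> one_tensor n (face n i b) = face (Suc n) (Suc i) b"
  by (rule vertices_ext[where m = "Suc n"])
    (auto simp: one_tensor_app face_app length_Suc_conv gr0_conv_Suc Suc_le_eq)

lemma one_tensor_degen:
  "1 \<le> i \<Longrightarrow> one_tensor (Suc n) (degen n i) = degen (Suc n) (Suc i)"
  by (rule vertices_ext[where m = "Suc (Suc n)"])
    (auto simp: one_tensor_app degen_app length_Suc_conv gr0_conv_Suc Suc_le_eq)

lemma one_tensor_conn:
  "1 \<le> i \<Longrightarrow> one_tensor (Suc n) (conn n i b) = conn (Suc n) (Suc i) b"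
  by (rule vertices_ext[where m = "Suc (Suc n)"])
    (auto simp: one_tensor_app conn_app length_Suc_conv gr0_conv_Suc Suc_le_eq)

text \<open>Tensoring raises the index of each generator by one and respects composition. Operators
  on loop objects act through it.\<close>

lemma cube_mor_one_tensor: "cube_mor m n \<phi> \<Longrightarrow> cube_mor (Suc m) (Suc n) (one_tensor m \<phi>)"
proof (induction rule: cube_mor.induct)
  case (cube_mor_comp l m \<phi> n \<psi>)
  then show ?case
    using cube_mor.cube_mor_comp[OF cube_mor_comp.IH] by (simp add: one_tensor_compose)
next
  case (cube_mor_degen i n)
  then show ?case by (simp add: one_tensor_degen cube_mor.cube_mor_degen)
next
  case (cube_mor_conn i n b)
  then obtain n' where "n = Suc n'" by (cases n) auto
  with cube_mor_conn show ?case by (simp add: one_tensor_conn cube_mor.cube_mor_conn)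
qed (simp_all add: one_tensor_idm one_tensor_face cube_mor.cube_mor_id cube_mor.cube_mor_face)

subsection \<open>Faces and constant cubes\<close>

definition bd :: "'a cset \<Rightarrow> nat \<Rightarrow> nat \<Rightarrow> bool \<Rightarrow> 'a \<Rightarrow> 'a" where
  "bd X n j b z = act X n (Suc n) (face n j b) z"

text \<open>The totally degenerate cube at \<open>x\<close>, taken along the unique map to
  \<open>[1]^0\<close> so that no order of degeneracies has to be chosen.\<close>

definition pt :: "'a cset \<Rightarrow> 'a \<Rightarrow> nat \<Rightarrow> 'a" where
  "pt X x n = act X n 0 (bang n) x"

lemma act_cells: "cubical_set X \<Longrightarrow> cube_mor m n \<phi> \<Longrightarrow> z \<in> cells X n \<Longrightarrow> act X m n \<phi> z \<in> cells X m"
  by (simp add: cubical_set_def)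

lemma act_idm: "cubical_set X \<Longrightarrow> z \<in> cells X n \<Longrightarrow> act X n n (idm n) z = z"
  by (simp add: cubical_set_def)

lemma act_compose:
  "cubical_set X \<Longrightarrow> cube_mor l m \<phi> \<Longrightarrow> cube_mor m n \<psi> \<Longrightarrow> z \<in> cells X n \<Longrightarrow>
   act X l m \<phi> (act X m n \<psi> z) = act X l n (compose (vertices l) \<psi> \<phi>) z"
  by (simp add: cubical_set_def)

lemma map_cells: "cubical_map X Y f \<Longrightarrow> z \<in> cells X n \<Longrightarrow> f n z \<in> cells Y n"
  by (simp add: cubical_map_def)

lemma map_act:
  "cubical_map X Y f \<Longrightarrow> cube_mor m n \<phi> \<Longrightarrow> z \<in> cells X n \<Longrightarrow> f m (act X m n \<phi> z) = act Y m n \<phi> (f n z)"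
  by (simp add: cubical_map_def)

lemma bd_cells [intro]:
  "cubical_set X \<Longrightarrow> z \<in> cells X (Suc n) \<Longrightarrow> 1 \<le> j \<Longrightarrow> j \<le> Suc n \<Longrightarrow> bd X n j b z \<in> cells X n"
  by (simp add: bd_def act_cells cube_mor_face)

lemma map_bd:
  "cubical_map X Y f \<Longrightarrow> z \<in> cells X (Suc n) \<Longrightarrow> 1 \<le> j \<Longrightarrow> j \<le> Suc n \<Longrightarrow>
   f n (bd X n j b z) = bd Y n j b (f (Suc n) z)"
  by (simp add: bd_def map_act cube_mor_face)

lemma bd_bd:
  "cubical_set X \<Longrightarrow> z \<in> cells X (Suc (Suc n)) \<Longrightarrow> 1 \<le> k \<Longrightarrow> k < j \<Longrightarrow> j \<le> Suc (Suc n) \<Longrightarrow>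
   bd X n k c (bd X (Suc n) j b z) = bd X n (j - 1) b (bd X (Suc n) k c z)"
  by (simp add: bd_def act_compose cube_mor_face face_face)

lemma pt_cells [intro]: "cubical_set X \<Longrightarrow> x \<in> cells X 0 \<Longrightarrow> pt X x n \<in> cells X n"
  by (simp add: pt_def act_cells cube_mor_bang)

lemma act_pt:
  "cubical_set X \<Longrightarrow> x \<in> cells X 0 \<Longrightarrow> cube_mor m n \<phi> \<Longrightarrow> act X m n \<phi> (pt X x n) = pt X x m"
  by (simp add: pt_def act_compose cube_mor_bang bang_compose)

lemma bd_pt:
  "cubical_set X \<Longrightarrow> x \<in> cells X 0 \<Longrightarrow> 1 \<le> j \<Longrightarrow> j \<le> Suc n \<Longrightarrow> bd X n j b (pt X x (Suc n)) = pt X x n"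
  by (simp add: bd_def act_pt cube_mor_face)

lemma pt_0: "cubical_set X \<Longrightarrow> x \<in> cells X 0 \<Longrightarrow> pt X x 0 = x"
  using act_idm[of X x 0] cube_mor_bang_unique[OF cube_mor_id[of 0]] by (simp add: pt_def)

lemma map_pt: "cubical_map X Y f \<Longrightarrow> x \<in> cells X 0 \<Longrightarrow> f n (pt X x n) = pt Y (f 0 x) n"
  by (simp add: pt_def map_act cube_mor_bang)

subsection \<open>Box filling in terms of faces\<close>

text \<open>Here \<open>n\<close> is the dimension of the faces, and the value of \<open>F\<close>
  at the missing face is arbitrary. Compatibility is asked only for \<open>k < j\<close>, as
  opposite faces are disjoint; this forces \<open>n \<ge> 1\<close>, so \<open>n - 1\<close> is a
  true predecessor.\<close>

definition box_filling :: "'a cset \<Rightarrow> 'b cset \<Rightarrow> (nat \<Rightarrow> 'a \<Rightarrow> 'b) \<Rightarrow> bool" where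
  "box_filling X Y p \<longleftrightarrow> (\<forall>n i \<epsilon> F y. 1 \<le> i \<longrightarrow> i \<le> Suc n \<longrightarrow>
     (\<forall>j b. 1 \<le> j \<longrightarrow> j \<le> Suc n \<longrightarrow> (j, b) \<noteq> (i, \<epsilon>) \<longrightarrow>
        F j b \<in> cells X n \<and> bd Y n j b y = p n (F j b)) \<longrightarrow>
     (\<forall>j b k c. 1 \<le> k \<longrightarrow> k < j \<longrightarrow> j \<le> Suc n \<longrightarrow> (j, b) \<noteq> (i, \<epsilon>) \<longrightarrow> (k, c) \<noteq> (i, \<epsilon>) \<longrightarrow>
        bd X (n - 1) k c (F j b) = bd X (n - 1) (j - 1) b (F k c)) \<longrightarrow>
     y \<in> cells Y (Suc n) \<longrightarrow>
     (\<exists>z\<in>cells X (Suc n). p (Suc n) z = y \<and>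
        (\<forall>j b. 1 \<le> j \<longrightarrow> j \<le> Suc n \<longrightarrow> (j, b) \<noteq> (i, \<epsilon>) \<longrightarrow> bd X n j b z = F j b)))"

text \<open>Covers equal directions when a map on the open box is defined: a face is injective, and
  opposite faces share no cube.\<close>

lemma face_compose_inj:
  assumes "cube_mor m n \<psi>" "cube_mor m n \<psi>'" "1 \<le> j" "j \<le> Suc n"
    and "compose (vertices m) (face n j b) \<psi> = compose (vertices m) (face n j c) \<psi>'"
  shows "b = c" "\<psi> = \<psi>'"
proof -
  have *: "b = c \<and> \<psi> v = \<psi>' v" if "length v = m" for v
    using fun_cong[OF assms(5), of v] that assms(3,4) cube_mor_length[OF assms(1) that]
      cube_mor_length[OF assms(2) that] ins_inj[of "j - 1" b "\<psi> v" c "\<psi>' v"]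
    by (simp add: compose_app face_app)
  \<comment> \<open>Some vertex of \<open>[1]^m\<close> is needed to compare \<open>b\<close> with
    \<open>c\<close>; any would do.\<close>
  show "b = c" using *[of "replicate m False"] by simp
  show "\<psi> = \<psi>'"
    by (rule vertices_ext[where m = m]) (use * assms(1,2) cube_mor_extensional in auto)
qed

text \<open>Two faces \<open>k < j\<close> of a cube meet in a face of codimension 2: \<open>\<chi>\<close> is \<open>\<psi>\<close> followed by the
  degeneracy that forgets the constant coordinate \<open>k\<close>.\<close>

lemma faces_meet:
  assumes "cube_mor m (Suc n) \<psi>" "cube_mor m (Suc n) \<psi>'" "1 \<le> k" "k < j" "j \<le> Suc (Suc n)"
    and eq: "compose (vertices m) (face (Suc n) j b) \<psi> = compose (vertices m) (face (Suc n) k c) \<psi>'"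
  obtains \<chi> where "cube_mor m n \<chi>" "\<psi> = compose (vertices m) (face n k c) \<chi>"
    "\<psi>' = compose (vertices m) (face n (j - 1) b) \<chi>"
proof -
  define \<chi> where "\<chi> = compose (vertices m) (degen n k) \<psi>"
  have \<chi>: "cube_mor m n \<chi>"
    unfolding \<chi>_def using assms(3-5) by (intro cube_mor_comp[OF assms(1)] cube_mor_degen) auto
  have \<psi>: "\<psi> = compose (vertices m) (face n k c) \<chi>"
  proof (rule vertices_ext[where m = m])
    fix v :: "bool list" assume v: "length v = m"
    note len = cube_mor_length[OF assms(1) v] cube_mor_length[OF assms(2) v]
    have "ins (j - 1) b (\<psi> v) = ins (k - 1) c (\<psi>' v)"
      using fun_cong[OF eq, of v] v len by (simp add: compose_app face_app)
    \<comment> \<open>As \<open>k < j\<close>, the insertion at \<open>j\<close> does not disturb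
      coordinate \<open>k\<close>; on the other side coordinate \<open>k\<close> is the inserted
      \<open>c\<close>.\<close>
    moreover have "ins (j - 1) b (\<psi> v) ! (k - 1) = \<psi> v ! (k - 1)"
      using assms(3-5) len by (intro nth_ins_less) auto
    moreover have "ins (k - 1) c (\<psi>' v) ! (k - 1) = c"
      using assms(3-5) len by (intro nth_ins) auto
    ultimately have "\<psi> v ! (k - 1) = c" by simp
    then have "ins (k - 1) c (take (k - 1) (\<psi> v) @ drop (Suc (k - 1)) (\<psi> v)) = \<psi> v"
      using assms(3-5) len by (intro ins_delete) auto
    moreover have "length (take (k - 1) (\<psi> v) @ drop k (\<psi> v)) = n"
      using assms(3-5) len by auto
    ultimately show "\<psi> v = compose (vertices m) (face n k c) \<chi> v"
      using v len assms(3) by (simp add: \<chi>_def compose_app degen_app face_app)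
  qed (use assms(1) cube_mor_extensional in auto)
  \<comment> \<open>Both sides of the claim on \<open>\<psi>'\<close> agree after the face
    \<open>k\<close>, by the cubical identity; that face is injective and cancels.\<close>
  have "compose (vertices m) (face (Suc n) k c) \<psi>'
      = compose (vertices m) (compose (vertices n) (face (Suc n) j b) (face n k c)) \<chi>"
    unfolding eq[symmetric] by (subst \<psi>) (rule compose_assoc_cube[OF \<chi>])
  also have "\<dots> = compose (vertices m) (face (Suc n) k c) (compose (vertices m) (face n (j - 1) b) \<chi>)"
    using assms(3-5) by (simp add: face_face compose_assoc_cube[OF \<chi>])
  finally have eq': "compose (vertices m) (face (Suc n) k c) \<psi>'
      = compose (vertices m) (face (Suc n) k c) (compose (vertices m) (face n (j - 1) b) \<chi>)" .
  have "cube_mor m (Suc n) (compose (vertices m) (face n (j - 1) b) \<chi>)"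
    using assms(3-5) by (intro cube_mor_comp[OF \<chi>] cube_mor_face) auto
  from face_compose_inj(2)[OF assms(2) this _ _ eq'] assms(3-5)
  have "\<psi>' = compose (vertices m) (face n (j - 1) b) \<chi>" by simp
  with that \<chi> \<psi> show thesis by blast
qed

lemma act_open_box: "act (open_box n i \<epsilon>) m k \<phi> \<psi> = compose (vertices m) \<psi> \<phi>"
  by (simp add: open_box_def cube_def)

text \<open>The lifting property is applied once, to the map \<open>u\<close> that \<open>F\<close>
  gives on the open box, over the Yoneda map \<open>v\<close> of \<open>y\<close>. The filler is the
  value of the lift at the identity of \<open>[1]^(n+1)\<close>.\<close>

lemma kan_fibration_box_filling:
  assumes X: "cubical_set X" and Y: "cubical_set Y" and kan: "kan_fibration X Y p"
  shows "box_filling X Y p"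
  unfolding box_filling_def
proof (intro allI impI)
  fix n i \<epsilon> F y
  assume i: "1 \<le> i" "i \<le> Suc n"
    and F0: "\<forall>j b. 1 \<le> j \<longrightarrow> j \<le> Suc n \<longrightarrow> (j, b) \<noteq> (i, \<epsilon>) \<longrightarrow>
        F j b \<in> cells X n \<and> bd Y n j b y = p n (F j b)"
    and comp0: "\<forall>j b k c. 1 \<le> k \<longrightarrow> k < j \<longrightarrow> j \<le> Suc n \<longrightarrow> (j, b) \<noteq> (i, \<epsilon>) \<longrightarrow> (k, c) \<noteq> (i, \<epsilon>) \<longrightarrow>
        bd X (n - 1) k c (F j b) = bd X (n - 1) (j - 1) b (F k c)"
    and y: "y \<in> cells Y (Suc n)"
  define face_index where "face_index j b \<longleftrightarrow> 1 \<le> j \<and> j \<le> Suc n \<and> (j, b) \<noteq> (i, \<epsilon>)" for j b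
  have F: "F j b \<in> cells X n" "bd Y n j b y = p n (F j b)" if "face_index j b" for j b
    using F0 that by (auto simp: face_index_def)
  have comp: "bd X (n - 1) k c (F j b) = bd X (n - 1) (j - 1) b (F k c)"
    if "face_index j b" "face_index k c" "k < j" for j b k c
    using comp0 that by (auto simp: face_index_def)
  have pX: "cubical_map X Y p" using kan by (simp add: kan_fibration_def)
  \<comment> \<open>The case of distinct directions, \<open>k\<close> being the smaller one. Both
    values are restrictions along \<open>\<chi>\<close> of the common face of codimension 2.\<close>
  have lt: "act X m n \<psi> (F j b) = act X m n \<psi>' (F k c)"
    if jb: "face_index j b" and kc: "face_index k c" and "k < j"
      and \<psi>: "cube_mor m n \<psi>" "cube_mor m n \<psi>'"
      and eq: "compose (vertices m) (face n j b) \<psi> = compose (vertices m) (face n k c) \<psi>'"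
    for j b k c m \<psi> \<psi>'
  proof -
    obtain n' where n: "n = Suc n'"
      using jb kc \<open>k < j\<close> by (cases n) (auto simp: face_index_def)
    have rng: "1 \<le> k" "j \<le> Suc (Suc n')" using jb kc n by (auto simp: face_index_def)
    obtain \<chi> where \<chi>: "cube_mor m n' \<chi>" "\<psi> = compose (vertices m) (face n' k c) \<chi>"
      "\<psi>' = compose (vertices m) (face n' (j - 1) b) \<chi>"
      using faces_meet[of m n' \<psi> \<psi>' k j b c] \<psi> eq rng \<open>k < j\<close> unfolding n by blast
    have faces: "cube_mor n' (Suc n') (face n' k c)" "cube_mor n' (Suc n') (face n' (j - 1) b)"
      using rng \<open>k < j\<close> by (auto intro!: cube_mor_face)
    have "act X m n \<psi> (F j b) = act X m n' \<chi> (bd X n' k c (F j b))"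
      using \<chi>(1) faces F(1)[OF jb] by (simp add: bd_def act_compose[OF X] n \<chi>(2))
    also have "\<dots> = act X m n' \<chi> (bd X n' (j - 1) b (F k c))"
      using comp[OF jb kc \<open>k < j\<close>] n by simp
    also have "\<dots> = act X m n \<psi>' (F k c)"
      using \<chi>(1) faces F(1)[OF kc] by (simp add: bd_def act_compose[OF X] n \<chi>(3))
    finally show ?thesis .
  qed
  have well: "act X m n \<psi> (F j b) = act X m n \<psi>' (F k c)"
    if jb: "face_index j b" and kc: "face_index k c"
      and \<psi>: "cube_mor m n \<psi>" "cube_mor m n \<psi>'"
      and eq: "compose (vertices m) (face n j b) \<psi> = compose (vertices m) (face n k c) \<psi>'"
    for j b k c m \<psi> \<psi>'
  proof (cases j k rule: linorder_cases)
    case equal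
    then show ?thesis
      using face_compose_inj[OF \<psi>, of k b c] eq kc by (auto simp: face_index_def)
  qed (use lt[OF jb kc _ \<psi> eq] lt[OF kc jb _ \<psi>(2,1) eq[symmetric]] in auto)
  define B where "B = open_box (Suc n) i \<epsilon>"
  \<comment> \<open>A cube of the box may factor through several faces, so one factorization is
    chosen; \<open>well\<close> makes the value independent of it.\<close>
  define u where "u m \<phi> = (SOME z. \<exists>j b \<psi>. face_index j b \<and> cube_mor m n \<psi> \<and>
    \<phi> = compose (vertices m) (face n j b) \<psi> \<and> z = act X m n \<psi> (F j b))" for m \<phi>
  have B: "\<phi> \<in> cells B m \<longleftrightarrow> (\<exists>j b \<psi>. face_index j b \<and> cube_mor m n \<psi> \<and>
    \<phi> = compose (vertices m) (face n j b) \<psi>)" for m \<phi>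
    by (auto simp: B_def open_box_def face_index_def)
  have u: "u m (compose (vertices m) (face n j b) \<psi>) = act X m n \<psi> (F j b)"
    if "face_index j b" "cube_mor m n \<psi>" for j b \<psi> m
  proof -
    have "\<exists>j' b' \<psi>'. face_index j' b' \<and> cube_mor m n \<psi>' \<and>
        compose (vertices m) (face n j b) \<psi> = compose (vertices m) (face n j' b') \<psi>' \<and>
        u m (compose (vertices m) (face n j b) \<psi>) = act X m n \<psi>' (F j' b')"
      unfolding u_def by (rule someI_ex) (use that in blast)
    then obtain j' b' \<psi>' where *: "face_index j' b'" "cube_mor m n \<psi>'"
        "compose (vertices m) (face n j b) \<psi> = compose (vertices m) (face n j' b') \<psi>'"
        "u m (compose (vertices m) (face n j b) \<psi>) = act X m n \<psi>' (F j' b')"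
      by blast
    show ?thesis using well[OF that(1) *(1) that(2) *(2,3)] *(4) by simp
  qed
  have mor: "cube_mor n (Suc n) (face n j b)" if "face_index j b" for j b
    using that by (auto simp: face_index_def intro: cube_mor_face)
  have umap: "cubical_map B X u"
    unfolding cubical_map_def
  proof (intro conjI allI impI)
    fix m \<phi> assume "\<phi> \<in> cells B m"
    then obtain j b \<psi> where jb: "face_index j b" "cube_mor m n \<psi>"
      and \<phi>: "\<phi> = compose (vertices m) (face n j b) \<psi>"
      using B[THEN iffD1] by blast
    show "u m \<phi> \<in> cells X m"
      unfolding \<phi> u[OF jb] by (rule act_cells[OF X jb(2) F(1)[OF jb(1)]])
  next
    fix l m \<phi> \<theta> assume \<phi>: "cube_mor l m \<phi>" and "\<theta> \<in> cells B m"
    then obtain j b \<psi> where jb: "face_index j b" "cube_mor m n \<psi>"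
      and \<theta>: "\<theta> = compose (vertices m) (face n j b) \<psi>"
      using B[THEN iffD1] by blast
    have "act B l m \<phi> \<theta> = compose (vertices l) (face n j b) (compose (vertices l) \<psi> \<phi>)"
      by (simp add: B_def act_open_box \<theta> compose_assoc_cube[OF \<phi>])
    then show "u l (act B l m \<phi> \<theta>) = act X l m \<phi> (u m \<theta>)"
      using u[OF jb(1) cube_mor_comp[OF \<phi> jb(2)]] u[OF jb] F(1)[OF jb(1)] \<phi> jb
      by (simp add: \<theta> act_compose[OF X])
  qed
  define v where "v m \<phi> = act Y m (Suc n) \<phi> y" for m \<phi>
  have vmap: "cubical_map (cube (Suc n)) Y v"
    using y by (auto simp: cubical_map_def cube_def v_def act_cells[OF Y] act_compose[OF Y])
  have square: "p m (u m \<phi>) = v m \<phi>" if \<phi>_in: "\<phi> \<in> cells B m" for m \<phi>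
  proof -
    obtain j b \<psi> where jb: "face_index j b" "cube_mor m n \<psi>"
      and \<phi>: "\<phi> = compose (vertices m) (face n j b) \<psi>"
      using B[THEN iffD1, OF \<phi>_in] by blast
    have "p m (u m \<phi>) = act Y m n \<psi> (p n (F j b))"
      using u[OF jb] map_act[OF pX jb(2)] F(1)[OF jb(1)] \<phi> by simp
    also have "\<dots> = act Y m n \<psi> (bd Y n j b y)" using F(2)[OF jb(1)] by simp
    also have "\<dots> = v m \<phi>"
      using y jb mor[OF jb(1)] by (simp add: bd_def v_def \<phi> act_compose[OF Y])
    finally show ?thesis .
  qed
  have rlp: "has_rlp B (cube (Suc n)) (\<lambda>k \<phi>. \<phi>) X Y p"
    using kan i unfolding kan_fibration_def B_def by simp
  have "\<exists>w. cubical_map (cube (Suc n)) X w \<and> (\<forall>k. \<forall>s\<in>cells B k. w k s = u k s) \<and>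
      (\<forall>k. \<forall>t\<in>cells (cube (Suc n)) k. p k (w k t) = v k t)"
    by (rule rlp[unfolded has_rlp_def, rule_format, OF umap vmap]) (rule square)
  then obtain w where w: "cubical_map (cube (Suc n)) X w" "\<And>m \<phi>. \<phi> \<in> cells B m \<Longrightarrow> w m \<phi> = u m \<phi>"
    "\<And>m \<phi>. \<phi> \<in> cells (cube (Suc n)) m \<Longrightarrow> p m (w m \<phi>) = v m \<phi>"
    by auto
  have id: "idm (Suc n) \<in> cells (cube (Suc n)) (Suc n)" by (simp add: cube_def cube_mor_id)
  show "\<exists>z\<in>cells X (Suc n). p (Suc n) z = y \<and>
        (\<forall>j b. 1 \<le> j \<longrightarrow> j \<le> Suc n \<longrightarrow> (j, b) \<noteq> (i, \<epsilon>) \<longrightarrow> bd X n j b z = F j b)"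
  proof (rule bexI[of _ "w (Suc n) (idm (Suc n))"], intro conjI allI impI)
    show "w (Suc n) (idm (Suc n)) \<in> cells X (Suc n)" using map_cells[OF w(1) id] .
    show "p (Suc n) (w (Suc n) (idm (Suc n))) = y"
      using w(3)[OF id] y by (simp add: v_def act_idm[OF Y])
  next
    fix j b assume "1 \<le> j" "j \<le> Suc n" "(j, b) \<noteq> (i, \<epsilon>)"
    then have jb: "face_index j b" by (simp add: face_index_def)
    have idl: "compose (vertices n) (idm (Suc n)) (face n j b) = face n j b"
      by (rule vertices_ext[where m = "n"]) (auto simp: compose_app idm_app face_app)
    have idr: "compose (vertices n) (face n j b) (idm n) = face n j b"
      by (rule vertices_ext[where m = "n"]) (auto simp: compose_app idm_app face_app)
    \<comment> \<open>Factoring through the identity displays the face itself as a cube of the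
      box.\<close>
    have in_B: "compose (vertices n) (face n j b) (idm n) \<in> cells B n"
      using jb cube_mor_id by (intro B[THEN iffD2] exI conjI) auto
    have "bd X n j b (w (Suc n) (idm (Suc n))) = w n (face n j b)"
      unfolding bd_def using map_act[OF w(1) mor[OF jb] id] idl by (simp add: cube_def)
    also have "\<dots> = u n (compose (vertices n) (face n j b) (idm n))"
      using w(2)[OF in_B] by (simp add: idr)
    also have "\<dots> = F j b"
      using u[OF jb cube_mor_id] F(1)[OF jb] by (simp add: act_idm[OF X])
    finally show "bd X n j b (w (Suc n) (idm (Suc n))) = F j b" .
  qed
qed

text \<open>A one-cell-per-dimension target turns relative box filling into the absolute Kan condition;
  unlike \<open>cube 0\<close> it is equal to its own loop object.\<close>

definition triv :: "unit cset" where
  "triv = \<lparr>cells = (\<lambda>_. UNIV), act = (\<lambda>_ _ _ _. ())\<rparr>"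

definition kan :: "'a cset \<Rightarrow> bool" where
  "kan X \<longleftrightarrow> cubical_set X \<and> box_filling X triv (\<lambda>_ _. ())"

lemma cubical_set_triv: "cubical_set triv"
  by (simp add: cubical_set_def triv_def)

lemma cells_triv [simp]: "z \<in> cells triv n"
  by (simp add: triv_def)

lemma cubical_set_cube: "cubical_set (cube n)"
proof -
  have "compose (vertices m) \<phi> (idm m) = \<phi>" if "cube_mor m n \<phi>" for m \<phi>
    by (rule vertices_ext[where m = m])
      (use cube_mor_extensional[OF that] in \<open>auto simp: compose_app idm_app\<close>)
  then show ?thesis
    by (auto simp: cubical_set_def cube_def compose_assoc_cube intro: cube_mor_comp)
qed

text \<open>\<open>cube 0\<close> and \<open>triv\<close> both have exactly one cube in each
  dimension, so boxes over them carry the same data.\<close>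

lemma kan_complex_kan:
  assumes "kan_complex X"
  shows "kan X"
proof -
  have X: "cubical_set X" using assms by (simp add: kan_complex_def)
  have fill: "box_filling X (cube 0) terminal_map"
    using assms kan_fibration_box_filling[OF X cubical_set_cube] by (simp add: kan_complex_def)
  have bang: "bd (cube 0) n j b (bang (Suc n)) = bang n" if "1 \<le> j" "j \<le> Suc n" for n j b
    using that by (simp add: bd_def cube_def bang_compose cube_mor_face)
  have "box_filling X triv (\<lambda>_ _. ())"
    unfolding box_filling_def
  proof (intro allI impI, goal_cases)
    case (1 n i \<epsilon> F y)
    have "\<exists>z\<in>cells X (Suc n). terminal_map (Suc n) z = bang (Suc n) \<and>
      (\<forall>j b. 1 \<le> j \<longrightarrow> j \<le> Suc n \<longrightarrow> (j, b) \<noteq> (i, \<epsilon>) \<longrightarrow> bd X n j b z = F j b)"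
    proof (rule fill[unfolded box_filling_def, rule_format], goal_cases)
      case (3 j b)
      with 1(3) bang[of j n b] show ?case by (simp add: terminal_map_def)
    next
      case (4 j b k c)
      with 1(4) show ?case by blast
    qed (use 1 in \<open>auto simp: cube_def cube_mor_bang\<close>)
    then show ?case by auto
  qed
  with X show ?thesis by (simp add: kan_def)
qed

subsection \<open>Squares and low-dimensional box filling\<close>

definition edge :: "'a cset \<Rightarrow> 'a \<Rightarrow> 'a \<Rightarrow> 'a \<Rightarrow> bool" where
  "edge X e u v \<longleftrightarrow> e \<in> cells X (Suc 0) \<and> bd X 0 (Suc 0) False e = u \<and> bd X 0 (Suc 0) True e = v"

text \<open>The arguments are left, right, bottom and top, with the first coordinate horizontal:
  \<open>l\<close> and \<open>r\<close> run along the second coordinate, \<open>b\<close> and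
  \<open>t\<close> along the first.\<close>

definition square :: "'a cset \<Rightarrow> 'a \<Rightarrow> 'a \<Rightarrow> 'a \<Rightarrow> 'a \<Rightarrow> 'a \<Rightarrow> bool" where
  "square X z l r b t \<longleftrightarrow> z \<in> cells X (Suc (Suc 0)) \<and>
     bd X (Suc 0) (Suc 0) False z = l \<and> bd X (Suc 0) (Suc 0) True z = r \<and>
     bd X (Suc 0) 2 False z = b \<and> bd X (Suc 0) 2 True z = t"

lemma edge_map: "cubical_map X Y f \<Longrightarrow> edge X e u v \<Longrightarrow> edge Y (f (Suc 0) e) (f 0 u) (f 0 v)"
  by (auto simp: edge_def map_cells map_bd)

lemma square_map:
  "cubical_map X Y f \<Longrightarrow> square X z l r b t \<Longrightarrow>
   square Y (f (Suc (Suc 0)) z) (f (Suc 0) l) (f (Suc 0) r) (f (Suc 0) b) (f (Suc 0) t)"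
  by (auto simp: square_def map_cells map_bd)

lemma square_edges:
  assumes "cubical_set X" "square X z l r b t"
  shows "edge X l (bd X 0 (Suc 0) False b) (bd X 0 (Suc 0) False t)"
    and "edge X r (bd X 0 (Suc 0) True b) (bd X 0 (Suc 0) True t)"
    and "b \<in> cells X (Suc 0)" "t \<in> cells X (Suc 0)"
  using assms bd_bd[OF assms(1), of z 0 "Suc 0" 2]
  by (auto simp: edge_def square_def intro!: bd_cells)

lemma edge_cells: "cubical_set X \<Longrightarrow> edge X e u v \<Longrightarrow> e \<in> cells X (Suc 0) \<and> u \<in> cells X 0 \<and> v \<in> cells X 0"
  by (auto simp: edge_def intro!: bd_cells)

lemma le_Suc_0_cases: "Suc 0 \<le> j \<Longrightarrow> j \<le> Suc 0 \<Longrightarrow> j = Suc 0"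
  by simp

lemma le_2_cases: "Suc 0 \<le> j \<Longrightarrow> j \<le> Suc (Suc 0) \<Longrightarrow> j = Suc 0 \<or> j = 2"
  by auto

lemma fill_edge:
  assumes "box_filling X Y p" "edge Y y u v" "p 0 w = (if b then v else u)" "w \<in> cells X 0"
  obtains z where "z \<in> cells X (Suc 0)" "p (Suc 0) z = y" "bd X 0 (Suc 0) b z = w"
proof -
  have "\<exists>z\<in>cells X (Suc 0). p (Suc 0) z = y \<and>
        (\<forall>j c. 1 \<le> j \<longrightarrow> j \<le> Suc 0 \<longrightarrow> (j, c) \<noteq> (1, \<not> b) \<longrightarrow> bd X 0 j c z = w)"
    \<comment> \<open>A one-dimensional box has a single face, so a constant family describes it;
      the missing end is the one opposite to \<open>b\<close>.\<close>
    by (rule assms(1)[unfolded box_filling_def, rule_format, where F = "\<lambda>_ _. w"])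
      (use assms in \<open>auto simp: edge_def dest!: le_Suc_0_cases split: if_splits\<close>)
  with that show thesis by auto
qed

text \<open>One statement serves all four boxes: the premise on the missing face is guarded, so its
  entry is arbitrary. In \<open>u00\<close> to \<open>u11\<close> the first digit is the first
  coordinate.\<close>

lemma fill_square:
  assumes fill: "box_filling X Y p" and y: "square Y y l' r' b' t'"
    and i: "i = Suc 0 \<or> i = 2"
    and l: "(i, \<epsilon>) \<noteq> (Suc 0, False) \<Longrightarrow> edge X l u00 u01 \<and> p (Suc 0) l = l'"
    and r: "(i, \<epsilon>) \<noteq> (Suc 0, True) \<Longrightarrow> edge X r u10 u11 \<and> p (Suc 0) r = r'"
    and b: "(i, \<epsilon>) \<noteq> (2, False) \<Longrightarrow> edge X b u00 u10 \<and> p (Suc 0) b = b'"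
    and t: "(i, \<epsilon>) \<noteq> (2, True) \<Longrightarrow> edge X t u01 u11 \<and> p (Suc 0) t = t'"
  obtains z where "z \<in> cells X (Suc (Suc 0))" "p (Suc (Suc 0)) z = y"
    "(i, \<epsilon>) \<noteq> (Suc 0, False) \<Longrightarrow> bd X (Suc 0) (Suc 0) False z = l"
    "(i, \<epsilon>) \<noteq> (Suc 0, True) \<Longrightarrow> bd X (Suc 0) (Suc 0) True z = r"
    "(i, \<epsilon>) \<noteq> (2, False) \<Longrightarrow> bd X (Suc 0) 2 False z = b"
    "(i, \<epsilon>) \<noteq> (2, True) \<Longrightarrow> bd X (Suc 0) 2 True z = t"
proof -
  define F where "F j c = (if j = Suc 0 then if c then r else l else if c then t else b)" for j :: nat and c
  have "\<exists>z\<in>cells X (Suc (Suc 0)). p (Suc (Suc 0)) z = y \<and>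
        (\<forall>j c. 1 \<le> j \<longrightarrow> j \<le> Suc (Suc 0) \<longrightarrow> (j, c) \<noteq> (i, \<epsilon>) \<longrightarrow> bd X (Suc 0) j c z = F j c)"
  proof (rule fill[unfolded box_filling_def, rule_format], goal_cases)
    case (3 j c)
    then have "j = Suc 0 \<or> j = 2" by (auto dest: le_2_cases)
    with 3 show ?case
      using y l r b t by (cases c) (auto simp: F_def edge_def square_def)
  next
    case (4 j c k d)
    then have "k = Suc 0" "j = 2" by auto
    with 4 show ?case
      using y l r b t by (cases c; cases d) (auto simp: F_def edge_def square_def)
  qed (use i y in \<open>auto simp: square_def\<close>)
  then obtain z where z: "z \<in> cells X (Suc (Suc 0))" "p (Suc (Suc 0)) z = y"
    and zF: "\<And>j c. 1 \<le> j \<Longrightarrow> j \<le> Suc (Suc 0) \<Longrightarrow> (j, c) \<noteq> (i, \<epsilon>) \<Longrightarrow> bd X (Suc 0) j c z = F j c"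
    by blast
  show thesis
    by (rule that[OF z]) (use zF[of 1] zF[of 2] in \<open>auto simp: F_def\<close>)
qed

text \<open>Edges of a 3-cube are indexed by their direction \<open>a, b, c\<close> and their two fixed coordinates;
  \<open>W j \<eta>\<close> is the face \<open>(j, \<eta>)\<close>, and any \<open>j\<close> other than 1 and 2 is read as 3.\<close>

definition shell ::
  "'a cset \<Rightarrow> (nat \<Rightarrow> bool \<Rightarrow> 'a) \<Rightarrow> (bool \<Rightarrow> bool \<Rightarrow> 'a) \<Rightarrow> (bool \<Rightarrow> bool \<Rightarrow> 'a) \<Rightarrow> (bool \<Rightarrow> bool \<Rightarrow> 'a) \<Rightarrow>
   nat \<Rightarrow> bool \<Rightarrow> bool" where
  "shell X W a b c j \<eta> \<longleftrightarrow>
     (if j = Suc 0 then square X (W j \<eta>) (c \<eta> False) (c \<eta> True) (b \<eta> False) (b \<eta> True)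
      else if j = 2 then square X (W j \<eta>) (c False \<eta>) (c True \<eta>) (a \<eta> False) (a \<eta> True)
      else square X (W j \<eta>) (b False \<eta>) (b True \<eta>) (a False \<eta>) (a True \<eta>))"

text \<open>The last conclusion is what later constructions extract: by the cubical identities, the
  edges of the missing face are those of its four neighbours.\<close>

lemma fill_cube:
  assumes X: "cubical_set X" and fill: "box_filling X Y p"
    and y: "y \<in> cells Y (Suc (Suc (Suc 0)))" and i: "i = Suc 0 \<or> i = 2 \<or> i = 3"
    and W: "\<And>j \<eta>. j = Suc 0 \<or> j = 2 \<or> j = 3 \<Longrightarrow> (j, \<eta>) \<noteq> (i, \<epsilon>) \<Longrightarrow>
      shell X W a b c j \<eta> \<and> bd Y (Suc (Suc 0)) j \<eta> y = p (Suc (Suc 0)) (W j \<eta>)"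
  obtains z where "z \<in> cells X (Suc (Suc (Suc 0)))" "p (Suc (Suc (Suc 0))) z = y"
    "\<And>j \<eta>. j = Suc 0 \<or> j = 2 \<or> j = 3 \<Longrightarrow> (j, \<eta>) \<noteq> (i, \<epsilon>) \<Longrightarrow> bd X (Suc (Suc 0)) j \<eta> z = W j \<eta>"
    "shell X (\<lambda>j \<eta>. bd X (Suc (Suc 0)) j \<eta> z) a b c i \<epsilon>"
proof -
  have "\<exists>z\<in>cells X (Suc (Suc (Suc 0))). p (Suc (Suc (Suc 0))) z = y \<and>
        (\<forall>j c. 1 \<le> j \<longrightarrow> j \<le> Suc (Suc (Suc 0)) \<longrightarrow> (j, c) \<noteq> (i, \<epsilon>) \<longrightarrow> bd X (Suc (Suc 0)) j c z = W j c)"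
  proof (rule fill[unfolded box_filling_def, rule_format], goal_cases)
    case (3 j \<eta>)
    from 3(1,2) have "j = Suc 0 \<or> j = 2 \<or> j = 3" by auto
    from W[OF this 3(3)] show ?case
      by (simp add: shell_def square_def split: if_splits)
  next
    case (4 j \<eta> k \<theta>)
    from 4(1-3) have jk: "j = 2 \<and> k = Suc 0 \<or> j = 3 \<and> k = Suc 0 \<or> j = 3 \<and> k = 2" by auto
    then have "shell X W a b c j \<eta>" "shell X W a b c k \<theta>"
      using W[of j \<eta>] W[of k \<theta>] 4(4,5) by blast+
    with jk show ?case
      by (cases \<eta>; cases \<theta>) (auto simp: shell_def square_def)
  qed (use i y in auto)
  then obtain z where z: "z \<in> cells X (Suc (Suc (Suc 0)))" "p (Suc (Suc (Suc 0))) z = y"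
    and zW: "\<And>j c. 1 \<le> j \<Longrightarrow> j \<le> Suc (Suc (Suc 0)) \<Longrightarrow> (j, c) \<noteq> (i, \<epsilon>) \<Longrightarrow>
      bd X (Suc (Suc 0)) j c z = W j c"
    by blast
  have zW': "bd X (Suc (Suc 0)) j \<eta> z = W j \<eta>" 
    if "j = Suc 0 \<or> j = 2 \<or> j = 3" "(j, \<eta>) \<noteq> (i, \<epsilon>)" for j \<eta>
    using that by (intro zW) auto
  have sh: "shell X (\<lambda>j \<eta>. bd X (Suc (Suc 0)) j \<eta> z) a b c j \<eta>"
    if "j = Suc 0 \<or> j = 2 \<or> j = 3" "(j, \<eta>) \<noteq> (i, \<epsilon>)" for j \<eta>
    using W[OF that] unfolding shell_def zW'[OF that] by blast
  note bb = bd_bd[OF X z(1), of "Suc 0" 2, simplified] bd_bd[OF X z(1), of "Suc 0" 3, simplified]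
    bd_bd[OF X z(1), of 2 3, simplified]
  have "bd X (Suc (Suc 0)) i \<epsilon> z \<in> cells X (Suc (Suc 0))"
    using i by (intro bd_cells[OF X z(1)]) auto
  then have "shell X (\<lambda>j \<eta>. bd X (Suc (Suc 0)) j \<eta> z) a b c i \<epsilon>"
    using i sh[of "Suc 0" False] sh[of "Suc 0" True] sh[of 2 False] sh[of 2 True] sh[of 3 False] sh[of 3 True]
      bb
    by (cases \<epsilon>) (elim disjE; simp add: shell_def square_def)+
  with that z zW' show thesis by blast
qed

definition Sq :: "'a cset \<Rightarrow> 'a \<Rightarrow> 'a \<Rightarrow> 'a \<Rightarrow> 'a \<Rightarrow> bool" where
  "Sq X l r b t \<longleftrightarrow> (\<exists>z. square X z l r b t)"

lemma square_triv: "square triv () () () () ()"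
  by (simp add: square_def)

text \<open>The missing face is \<open>(2, False)\<close>. Making suitable edges constant turns this
  into uniqueness or associativity of products.\<close>

lemma Sq_fill_cube:
  assumes "kan X"
    and "Sq X c00 c01 b00 b01" "Sq X c10 c11 b10 b11" "Sq X c01 c11 a10 a11"
    and "Sq X b00 b10 a00 a10" "Sq X b01 b11 a01 a11"
  shows "Sq X c00 c10 a00 a01"
proof -
  obtain z10 z11 z21 z30 z31 where z: "square X z10 c00 c01 b00 b01" "square X z11 c10 c11 b10 b11"
    "square X z21 c01 c11 a10 a11" "square X z30 b00 b10 a00 a10" "square X z31 b01 b11 a01 a11"
    using assms(2-) unfolding Sq_def by blast
  define W where "W j \<eta> = (if j = Suc 0 then if \<eta> then z11 else z10
    else if j = 2 then z21 else if \<eta> then z31 else z30)" for j :: nat and \<eta>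
  define entry where "entry u00 u01 u10 u11 \<beta> \<gamma> =
    (if \<beta> then if \<gamma> then u11 else u10 else if \<gamma> then u01 else u00)" for u00 u01 u10 u11 :: 'a and \<beta> \<gamma>
  have c: "cubical_set X" and fill: "box_filling X triv (\<lambda>_ _. ())" using assms(1) by (auto simp: kan_def)
  have sh: "shell X W (entry a00 a01 a10 a11) (entry b00 b01 b10 b11) (entry c00 c01 c10 c11) j \<eta>"
    if "j = Suc 0 \<or> j = 2 \<or> j = 3" "(j, \<eta>) \<noteq> (2, False)" for j \<eta>
    using that z by (cases \<eta>) (auto simp: shell_def W_def entry_def)
  obtain w where "shell X (\<lambda>j \<eta>. bd X (Suc (Suc 0)) j \<eta> w)
      (entry a00 a01 a10 a11) (entry b00 b01 b10 b11) (entry c00 c01 c10 c11) 2 False"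
    by (rule fill_cube[OF c fill, of "()" 2 False W, OF _ _ conjI[OF sh]]) auto
  then show ?thesis by (auto simp: shell_def entry_def Sq_def)
qed

subsection \<open>Degenerate squares\<close>

lemma act_1_0: "cubical_set X \<Longrightarrow> act X (Suc 0) 0 (degen 0 (Suc 0)) x = pt X x (Suc 0)"
  using cube_mor_bang_unique[OF cube_mor_degen[of "Suc 0" 0]] by (simp add: pt_def)

lemma edge_pt: "cubical_set X \<Longrightarrow> x \<in> cells X 0 \<Longrightarrow> edge X (pt X x (Suc 0)) x x"
  by (simp add: edge_def bd_pt pt_0 pt_cells)

lemma square_pt:
  "cubical_set X \<Longrightarrow> x \<in> cells X 0 \<Longrightarrow>
   square X (pt X x (Suc (Suc 0))) (pt X x (Suc 0)) (pt X x (Suc 0)) (pt X x (Suc 0)) (pt X x (Suc 0))"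
  by (simp add: square_def bd_pt pt_cells)

lemma bd_act:
  "cubical_set X \<Longrightarrow> cube_mor (Suc m) n \<phi> \<Longrightarrow> z \<in> cells X n \<Longrightarrow> 1 \<le> j \<Longrightarrow> j \<le> Suc m \<Longrightarrow>
   bd X m j b (act X (Suc m) n \<phi> z) = act X m n (compose (vertices m) \<phi> (face m j b)) z"
  by (simp add: bd_def act_compose cube_mor_face)

text \<open>Handles the collapsed faces of degenerate squares, whose operator factors through one
  vertex.\<close>

lemma act_face_bang:
  assumes X: "cubical_set X" and "e \<in> cells X (Suc 0)"
  shows "act X m (Suc 0) (compose (vertices m) (face 0 (Suc 0) b) (bang m)) e = pt X (bd X 0 (Suc 0) b e) m"
  using assms by (simp add: pt_def bd_def act_compose cube_mor_bang cube_mor_face)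

lemma square_degen_1:
  assumes X: "cubical_set X" and e: "edge X e u v"
  shows "square X (act X (Suc (Suc 0)) (Suc 0) (degen (Suc 0) (Suc 0)) e) e e (pt X u (Suc 0)) (pt X v (Suc 0))"
proof -
  have e1: "e \<in> cells X (Suc 0)" using e by (simp add: edge_def)
  have mor: "cube_mor (Suc (Suc 0)) (Suc 0) (degen (Suc 0) (Suc 0))" by (rule cube_mor_degen) auto
  have "compose (vertices (Suc 0)) (degen (Suc 0) (Suc 0)) (face (Suc 0) (Suc 0) b) = idm (Suc 0)" for b
    by (rule vertices_ext[where m = "Suc 0"])
      (auto simp: compose_app face_app degen_app idm_app length_Suc_conv)
  moreover have "compose (vertices (Suc 0)) (degen (Suc 0) (Suc 0)) (face (Suc 0) 2 b)
      = compose (vertices (Suc 0)) (face 0 (Suc 0) b) (bang (Suc 0))" for b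
    by (rule vertices_ext[where m = "Suc 0"])
      (auto simp: compose_app face_app degen_app length_Suc_conv)
  ultimately show ?thesis
    using e by (simp add: square_def act_cells[OF X mor] e1 bd_act[OF X mor e1] act_idm[OF X e1]
        act_face_bang[OF X e1] edge_def)
qed

lemma square_degen_2:
  assumes X: "cubical_set X" and e: "edge X e u v"
  shows "square X (act X (Suc (Suc 0)) (Suc 0) (degen (Suc 0) 2) e) (pt X u (Suc 0)) (pt X v (Suc 0)) e e"
proof -
  have e1: "e \<in> cells X (Suc 0)" using e by (simp add: edge_def)
  have mor: "cube_mor (Suc (Suc 0)) (Suc 0) (degen (Suc 0) 2)" by (rule cube_mor_degen) auto
  have "compose (vertices (Suc 0)) (degen (Suc 0) 2) (face (Suc 0) 2 b) = idm (Suc 0)" for b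
    by (rule vertices_ext[where m = "Suc 0"])
      (auto simp: compose_app face_app degen_app idm_app length_Suc_conv)
  moreover have "compose (vertices (Suc 0)) (degen (Suc 0) 2) (face (Suc 0) (Suc 0) b)
      = compose (vertices (Suc 0)) (face 0 (Suc 0) b) (bang (Suc 0))" for b
    by (rule vertices_ext[where m = "Suc 0"])
      (auto simp: compose_app face_app degen_app length_Suc_conv)
  ultimately show ?thesis
    using e by (simp add: square_def act_cells[OF X mor] e1 bd_act[OF X mor e1] act_idm[OF X e1]
        act_face_bang[OF X e1] edge_def)
qed

subsection \<open>Path components\<close>

definition path_rel :: "'a cset \<Rightarrow> 'a \<Rightarrow> 'a \<Rightarrow> bool" where
  "path_rel X u v \<longleftrightarrow> (\<exists>e. edge X e u v)"

lemma path_rel_refl: "cubical_set X \<Longrightarrow> u \<in> cells X 0 \<Longrightarrow> path_rel X u u"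
  unfolding path_rel_def by (rule exI) (rule edge_pt)

text \<open>If \<open>e\<close> and \<open>g\<close> start at the same vertex, then the ends of \<open>e\<close> and \<open>g\<close> are joined by the right
  face of a square with bottom \<open>e\<close>, constant left face and top \<open>g\<close>.\<close>

lemma path_rel_euclidean:
  assumes X: "kan X" and "path_rel X u v" "path_rel X u w"
  shows "path_rel X v w"
proof -
  obtain e g where eg: "edge X e u v" "edge X g u w" using assms by (auto simp: path_rel_def)
  have c: "cubical_set X" and fill: "box_filling X triv (\<lambda>_ _. ())" using X by (auto simp: kan_def)
  have u: "u \<in> cells X 0" using edge_cells[OF c eg(1)] by simp
  obtain z where z: "square X z (pt X u (Suc 0)) (bd X (Suc 0) (Suc 0) True z) e g"
    by (rule fill_square[OF fill square_triv, of "Suc 0" True "pt X u (Suc 0)" u u _ v w e g])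
      (use eg edge_pt[OF c u] in \<open>auto simp: square_def\<close>)
  from square_edges(2)[OF c z] eg show ?thesis by (auto simp: path_rel_def edge_def)
qed

lemma path_rel_cells: "cubical_set X \<Longrightarrow> path_rel X u v \<Longrightarrow> u \<in> cells X 0 \<and> v \<in> cells X 0"
  by (auto simp: path_rel_def dest: edge_cells)

lemma path_rel_sym: "kan X \<Longrightarrow> path_rel X u v \<Longrightarrow> path_rel X v u"
  using path_rel_euclidean[of X u v u] path_rel_refl[of X u] path_rel_cells[of X u v]
  by (auto simp: kan_def)

lemma path_rel_trans: "kan X \<Longrightarrow> path_rel X u v \<Longrightarrow> path_rel X v w \<Longrightarrow> path_rel X u w"
  by (rule path_rel_euclidean[OF _ path_rel_sym])

section \<open>Vertices of a cube and classes in the colimit\<close>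

definition vertex_mor :: "bool list \<Rightarrow> cmor" where
  "vertex_mor v = restrict (\<lambda>_. v) (vertices 0)"

lemma vertex_mor_extensional [simp]: "vertex_mor v \<in> extensional (vertices 0)"
  unfolding vertex_mor_def by (rule restrict_extensional)

lemma vertex_mor_app: "vertex_mor v [] = v"
  by (simp add: vertex_mor_def vertices_def)

lemma vertex_mor_Cons: "vertex_mor (b # v) = compose (vertices 0) (face (length v) 1 b) (vertex_mor v)"
  by (rule vertices_ext[where m = 0]) (auto simp: compose_app vertex_mor_app face_app)

lemma cube_mor_vertex: "cube_mor 0 (length v) (vertex_mor v)"
proof (induction v)
  case Nil
  have "vertex_mor [] = idm 0"
    by (rule vertices_ext[where m = 0]) (auto simp: vertex_mor_app idm_app)
  then show ?case using cube_mor_id[of 0] by simp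
next
  case (Cons b v)
  show ?case
    unfolding vertex_mor_Cons using Cons.IH by (intro cube_mor_comp[where m = "length v"]) (auto intro: cube_mor_face)
qed

definition vertex_at :: "'a cset \<Rightarrow> bool list \<Rightarrow> 'a \<Rightarrow> 'a" where
  "vertex_at X v z = act X 0 (length v) (vertex_mor v) z"

lemma vertex_at_cells: "cubical_set X \<Longrightarrow> z \<in> cells X (length v) \<Longrightarrow> vertex_at X v z \<in> cells X 0"
  by (simp add: vertex_at_def act_cells cube_mor_vertex)

lemma vertex_at_Cons:
  "cubical_set X \<Longrightarrow> z \<in> cells X (Suc (length v)) \<Longrightarrow>
   vertex_at X (b # v) z = vertex_at X v (bd X (length v) 1 b z)"
  by (simp add: vertex_at_def vertex_mor_Cons bd_def act_compose cube_mor_vertex cube_mor_face)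

lemma vertex_at_0: "cubical_set X \<Longrightarrow> z \<in> cells X 0 \<Longrightarrow> vertex_at X [] z = z"
  using cube_mor_bang_unique[OF cube_mor_vertex[of "[]", simplified]] pt_0[of X z]
  by (simp add: vertex_at_def pt_def)

lemma vertex_at_act:
  assumes X: "cubical_set X" and \<phi>: "cube_mor (length v) n \<phi>" and z: "z \<in> cells X n"
  shows "vertex_at X v (act X (length v) n \<phi> z) = vertex_at X (\<phi> v) z"
proof -
  have "length (\<phi> v) = n" using cube_mor_length[OF \<phi>] by simp
  moreover have "compose (vertices 0) \<phi> (vertex_mor v) = vertex_mor (\<phi> v)"
    by (rule vertices_ext[where m = 0]) (auto simp: compose_app vertex_mor_app)
  ultimately show ?thesis
    using \<phi> z by (simp add: vertex_at_def act_compose[OF X cube_mor_vertex])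
qed

lemma path_rel_first_coordinate:
  assumes X: "cubical_set X" and z: "z \<in> cells X (Suc (length v))"
  shows "path_rel X (vertex_at X (False # v) z) (vertex_at X (True # v) z)"
proof -
  \<comment> \<open>The interval map \<open>t |-> (t, v)\<close>; restricting \<open>z\<close> along
    it gives the required edge.\<close>
  define \<theta> where "\<theta> = one_tensor 0 (vertex_mor v)"
  have \<theta>: "cube_mor (Suc 0) (Suc (length v)) \<theta>"
    unfolding \<theta>_def by (rule cube_mor_one_tensor[OF cube_mor_vertex])
  have "compose (vertices 0) \<theta> (face 0 (Suc 0) b) = vertex_mor (b # v)" for b
    by (rule vertices_ext[where m = 0])
      (auto simp: compose_app vertex_mor_app \<theta>_def face_app one_tensor_app)
  then have "edge X (act X (Suc 0) (Suc (length v)) \<theta> z) (vertex_at X (False # v) z) (vertex_at X (True # v) z)"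
    using z by (simp add: edge_def act_cells[OF X \<theta>] bd_act[OF X \<theta>] vertex_at_def)
  then show ?thesis by (auto simp: path_rel_def)
qed

text \<open>Coordinates are set to 0 one at a time: the tail inside the face where the first
  coordinate is \<open>b\<close>, then the first one along an edge. Reversing and concatenating
  paths needs the Kan condition.\<close>

lemma path_rel_vertices:
  assumes X: "kan X"
  shows "z \<in> cells X (length v) \<Longrightarrow> path_rel X (vertex_at X v z) (vertex_at X (replicate (length v) False) z)"
proof (induction v arbitrary: z)
  case Nil
  with X show ?case by (auto simp: kan_def intro!: path_rel_refl vertex_at_cells)
next
  case (Cons b v)
  have c: "cubical_set X" using X by (simp add: kan_def)
  have "bd X (length v) 1 b z \<in> cells X (length v)" using Cons.prems by (intro bd_cells[OF c]) auto
  from Cons.IH[OF this]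
  have 1: "path_rel X (vertex_at X (b # v) z) (vertex_at X (b # replicate (length v) False) z)"
    using Cons.prems vertex_at_Cons[OF c, of z v b] vertex_at_Cons[OF c, of z "replicate (length v) False" b]
    by simp
  have FT: "path_rel X (vertex_at X (False # replicate (length v) False) z) (vertex_at X (True # replicate (length v) False) z)"
    using Cons.prems by (intro path_rel_first_coordinate[OF c]) auto
  have "path_rel X (vertex_at X (b # replicate (length v) False) z) (vertex_at X (False # replicate (length v) False) z)"
    using path_rel_sym[OF X FT] path_rel_refl[OF c] path_rel_cells[OF c FT] by (cases b) simp_all
  from path_rel_trans[OF X 1 this] show ?case by simp
qed

lemma equiv_cube_equiv: "equiv UNIV (cube_equiv X)"
  unfolding cube_equiv_def
  by (intro equivI) (auto simp: refl_on_def intro!: sym_rtrancl sym_Un_converse trans_rtrancl)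

lemma cube_equivI: "cube_mor m n \<phi> \<Longrightarrow> z \<in> cells X n \<Longrightarrow> ((n, z), (m, act X m n \<phi> z)) \<in> cube_equiv X"
  unfolding cube_equiv_def by (rule r_into_rtrancl) (auto simp: cube_step_def)

lemma pi0_class_eq_iff: "pi0_class X n z = pi0_class X m w \<longleftrightarrow> ((n, z), (m, w)) \<in> cube_equiv X"
  unfolding pi0_class_def by (rule eq_equiv_class_iff[OF equiv_cube_equiv]) auto

lemma pi0_class_act: "cube_mor m n \<phi> \<Longrightarrow> z \<in> cells X n \<Longrightarrow> pi0_class X m (act X m n \<phi> z) = pi0_class X n z"
  unfolding pi0_class_eq_iff using cube_equivI equiv_cube_equiv[of X] by (meson equivE symE)

text \<open>The invariant of a zigzag is the path component of the vertex at 0. One step replaces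
  this vertex by another vertex of the same cube, and all vertices of a cube are connected.\<close>

lemma cube_equiv_path_rel:
  assumes X: "kan X" and "(p, q) \<in> cube_equiv X" and "snd p \<in> cells X (fst p)"
  shows "snd q \<in> cells X (fst q) \<and>
    path_rel X (vertex_at X (replicate (fst p) False) (snd p)) (vertex_at X (replicate (fst q) False) (snd q))"
  using assms(2) unfolding cube_equiv_def
proof (induction rule: rtrancl_induct)
  case base
  show ?case
    using assms(3) path_rel_vertices[OF X, of "snd p" "replicate (fst p) False"] by simp
next
  case (step q r)
  have c: "cubical_set X" using X by (simp add: kan_def)
  have *: "act X m n \<phi> z \<in> cells X m \<and>
      path_rel X (vertex_at X (replicate n False) z) (vertex_at X (replicate m False) (act X m n \<phi> z))"
    if "cube_mor m n \<phi>" "z \<in> cells X n" for m n \<phi> z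
  proof -
    have "vertex_at X (replicate m False) (act X m n \<phi> z) = vertex_at X (\<phi> (replicate m False)) z"
      using vertex_at_act[OF c, of "replicate m False" n \<phi> z] that by simp
    moreover have "path_rel X (vertex_at X (\<phi> (replicate m False)) z) (vertex_at X (replicate n False) z)"
      using path_rel_vertices[OF X, of z "\<phi> (replicate m False)"] that
        cube_mor_length[OF that(1), of "replicate m False"] by simp
    ultimately show ?thesis
      using path_rel_sym[OF X] act_cells[OF c that] by simp
  qed
  from step(2) show ?case
  proof
    assume "(q, r) \<in> cube_step X"
    then obtain m k \<phi> w where w: "q = (k, w)" "r = (m, act X m k \<phi> w)" "cube_mor m k \<phi>" "w \<in> cells X k"
      by (auto simp: cube_step_def)
    with *[OF w(3,4)] step(3) path_rel_trans[OF X] show ?thesis by auto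
  next
    assume "(q, r) \<in> (cube_step X)\<inverse>"
    then obtain m k \<phi> w where w: "r = (k, w)" "q = (m, act X m k \<phi> w)" "cube_mor m k \<phi>" "w \<in> cells X k"
      by (auto simp: cube_step_def)
    with path_rel_sym[OF X conjunct2[OF *[OF w(3,4)]]] step(3) path_rel_trans[OF X] show ?thesis by auto
  qed
qed

lemma pi0_class_eq_path:
  assumes X: "kan X" and u: "u \<in> cells X 0" and v: "v \<in> cells X 0"
  shows "pi0_class X 0 u = pi0_class X 0 v \<longleftrightarrow> path_rel X u v"
proof
  have c: "cubical_set X" using X by (simp add: kan_def)
  assume "pi0_class X 0 u = pi0_class X 0 v"
  then show "path_rel X u v"
    using cube_equiv_path_rel[OF X, of "(0, u)" "(0, v)"] u v
    by (simp add: pi0_class_eq_iff vertex_at_0[OF c])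
next
  assume "path_rel X u v"
  then obtain e where e: "edge X e u v" by (auto simp: path_rel_def)
  have "pi0_class X 0 (bd X 0 (Suc 0) b e) = pi0_class X (Suc 0) e" for b
    unfolding bd_def using e by (intro pi0_class_act cube_mor_face) (auto simp: edge_def)
  from this[of False] this[of True] e show "pi0_class X 0 u = pi0_class X 0 v"
    by (simp add: edge_def)
qed

text \<open>Every cube is identified in the colimit with its vertices.\<close>

lemma pi0_eq_image:
  assumes c: "cubical_set X"
  shows "pi0 X = pi0_class X 0 ` cells X 0"
proof (intro Set.set_eqI iffI)
  fix C assume "C \<in> pi0 X"
  then obtain n z where z: "z \<in> cells X n" and C: "C = pi0_class X n z"
    unfolding pi0_def pi0_class_def by (auto elim!: quotientE)
  have "pi0_class X 0 (vertex_at X (replicate n False) z) = C"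
    unfolding vertex_at_def C using z cube_mor_vertex[of "replicate n False"] by (simp add: pi0_class_act)
  then show "C \<in> pi0_class X 0 ` cells X 0"
    using vertex_at_cells[OF c, of z "replicate n False"] z by auto
qed (auto simp: pi0_def pi0_class_def intro!: quotientI)

text \<open>By naturality \<open>f\<close> sends zigzags to zigzags; the saturation in
  \<open>pi0_map\<close> then fills the image up to a whole class. Membership in
  \<open>cells X\<close> is carried along because naturality holds only there.\<close>

lemma pi0_map_class:
  assumes X: "cubical_set X" and f: "cubical_map X Y f" and z: "z \<in> cells X n"
  shows "pi0_map Y f (pi0_class X n z) = pi0_class Y n (f n z)"
proof -
  have *: "snd q \<in> cells X (fst q) \<and> ((n, f n z), (fst q, f (fst q) (snd q))) \<in> cube_equiv Y"
    if "((n, z), q) \<in> cube_equiv X" for q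
    using that unfolding cube_equiv_def[of X]
  proof (induction rule: rtrancl_induct)
    case base
    then show ?case using z equiv_cube_equiv[of Y] by (auto simp: equiv_def refl_on_def)
  next
    case (step q r)
    have tr: "trans (cube_equiv Y)" and sy: "sym (cube_equiv Y)"
      using equiv_cube_equiv[of Y] by (auto elim: equivE)
    have f_step: "((k, f k w), (m, f m (act X m k \<phi> w))) \<in> cube_equiv Y"
      if "cube_mor m k \<phi>" "w \<in> cells X k" for m k \<phi> w
      using that map_act[OF f that] cube_equivI[OF that(1) map_cells[OF f that(2)]] by simp
    from step(2) show ?case
    proof
      assume "(q, r) \<in> cube_step X"
      then obtain m k \<phi> w where w: "q = (k, w)" "r = (m, act X m k \<phi> w)" "cube_mor m k \<phi>" "w \<in> cells X k"
        by (auto simp: cube_step_def)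
      then show ?thesis
        using step(3) transD[OF tr _ f_step[OF w(3,4)]] act_cells[OF X w(3,4)] by simp
    next
      assume "(q, r) \<in> (cube_step X)\<inverse>"
      then obtain m k \<phi> w where w: "r = (k, w)" "q = (m, act X m k \<phi> w)" "cube_mor m k \<phi>" "w \<in> cells X k"
        by (auto simp: cube_step_def)
      then show ?thesis
        using step(3) transD[OF tr _ symD[OF sy f_step[OF w(3,4)]]] by simp
    qed
  qed
  show ?thesis
  proof (intro Set.set_eqI iffI)
    fix q assume "q \<in> pi0_map Y f (pi0_class X n z)"
    then obtain p where "((n, z), p) \<in> cube_equiv X" "((fst p, f (fst p) (snd p)), q) \<in> cube_equiv Y"
      by (auto simp: pi0_map_def pi0_class_def)
    with *[of p] show "q \<in> pi0_class Y n (f n z)"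
      using equiv_cube_equiv[of Y] unfolding pi0_class_def equiv_def by (meson Image_singleton_iff transD)
  next
    fix q assume "q \<in> pi0_class Y n (f n z)"
    moreover have "((n, z), (n, z)) \<in> cube_equiv X" by (simp add: cube_equiv_def)
    ultimately show "q \<in> pi0_map Y f (pi0_class X n z)"
      unfolding pi0_map_def pi0_class_def by force
  qed
qed

subsection \<open>Loop objects\<close>

definition Loop :: "'a cset \<Rightarrow> 'a \<Rightarrow> 'a cset" where
  "Loop X x = fst (loop (X, x))"

lemma loop_eq: "cubical_set X \<Longrightarrow> loop (X, x) = (Loop X x, pt X x (Suc 0))"
  by (simp add: Loop_def loop_def act_1_0)

lemma act_Loop: "act (Loop X x) m n \<phi> = act X (Suc m) (Suc n) (one_tensor m \<phi>)"
  by (simp add: Loop_def loop_def fiber_def path_cset_def)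

lemma cells_Loop:
  "z \<in> cells (Loop X x) k \<longleftrightarrow> z \<in> cells X (Suc k) \<and>
     bd X k (Suc 0) False z = pt X x k \<and> bd X k (Suc 0) True z = pt X x k"
  by (simp add: Loop_def loop_def fiber_def path_cset_def path_ends_def prod_cset_def point_def bd_def pt_def)

lemma bd_first_Loop: "z \<in> cells (Loop X x) k \<Longrightarrow> bd X k (Suc 0) b z = pt X x k"
  by (cases b) (simp_all add: cells_Loop)

text \<open>The first coordinate of \<open>X\<close> is the loop coordinate, so directions shift by
  one.\<close>

lemma bd_Loop: "1 \<le> j \<Longrightarrow> bd (Loop X x) k j b z = bd X (Suc k) (Suc j) b z"
  by (simp add: bd_def act_Loop one_tensor_face)

lemma pt_cells_Loop: "cubical_set X \<Longrightarrow> x \<in> cells X 0 \<Longrightarrow> pt X x (Suc k) \<in> cells (Loop X x) k"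
  by (simp add: cells_Loop bd_pt pt_cells)

lemma pt_Loop: "cubical_set X \<Longrightarrow> x \<in> cells X 0 \<Longrightarrow> pt (Loop X x) (pt X x (Suc 0)) k = pt X x (Suc k)"
  by (simp add: pt_def[of "Loop X x"] act_Loop act_pt cube_mor_one_tensor cube_mor_bang)

text \<open>Because of this, operators on the later coordinates preserve the condition that the
  faces in the first one be constant.\<close>

lemma one_tensor_face_commute:
  assumes "cube_mor m n \<phi>"
  shows "compose (vertices m) (one_tensor m \<phi>) (face m (Suc 0) b) = compose (vertices m) (face n (Suc 0) b) \<phi>"
  by (rule vertices_ext[where m = m])
    (auto simp: compose_app face_app one_tensor_app cube_mor_length[OF assms])

lemma cubical_set_Loop:
  assumes X: "cubical_set X" and x: "x \<in> cells X 0"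
  shows "cubical_set (Loop X x)"
  unfolding cubical_set_def
proof (intro conjI allI impI)
  fix m n \<phi> z assume \<phi>: "cube_mor m n \<phi>" and zL: "z \<in> cells (Loop X x) n"
  have z: "z \<in> cells X (Suc n)" and zb: "\<And>b. bd X n (Suc 0) b z = pt X x n"
    using zL bd_first_Loop[OF zL] by (simp_all add: cells_Loop)
  have "bd X m (Suc 0) b (act X (Suc m) (Suc n) (one_tensor m \<phi>) z) = pt X x m" for b
  proof -
    have "bd X m (Suc 0) b (act X (Suc m) (Suc n) (one_tensor m \<phi>) z) = act X m n \<phi> (bd X n (Suc 0) b z)"
      using X \<phi> z
      by (simp add: bd_def act_compose cube_mor_one_tensor cube_mor_face one_tensor_face_commute)
    then show ?thesis using act_pt[OF X x \<phi>] zb by simp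
  qed
  then show "act (Loop X x) m n \<phi> z \<in> cells (Loop X x) m"
    using act_cells[OF X cube_mor_one_tensor[OF \<phi>] z] by (simp add: cells_Loop act_Loop)
next
  fix n z assume "z \<in> cells (Loop X x) n"
  then show "act (Loop X x) n n (idm n) z = z"
    by (simp add: act_Loop one_tensor_idm act_idm[OF X] cells_Loop)
next
  fix l m n \<phi> \<psi> z
  assume "cube_mor l m \<phi>" "cube_mor m n \<psi>" "z \<in> cells (Loop X x) n"
  then show "act (Loop X x) l n (compose (vertices l) \<psi> \<phi>) z = act (Loop X x) l m \<phi> (act (Loop X x) m n \<psi> z)"
    by (simp add: act_Loop one_tensor_compose act_compose[OF X] cube_mor_one_tensor cells_Loop)
qed

lemma cubical_map_Loop:
  assumes f: "cubical_map X Y f" and x: "x \<in> cells X 0"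
  shows "cubical_map (Loop X x) (Loop Y (f 0 x)) (loop_map f)"
  unfolding cubical_map_def
proof (intro conjI allI impI)
  fix n z assume "z \<in> cells (Loop X x) n"
  then show "loop_map f n z \<in> cells (Loop Y (f 0 x)) n"
    using map_bd[OF f, of z n "Suc 0"] map_pt[OF f x, of n] map_cells[OF f, of z "Suc n"]
    by (auto simp: cells_Loop loop_map_def dest: sym)
next
  fix m n \<phi> z assume "cube_mor m n \<phi>" "z \<in> cells (Loop X x) n"
  then show "loop_map f m (act (Loop X x) m n \<phi> z) = act (Loop Y (f 0 x)) m n \<phi> (loop_map f n z)"
    by (simp add: act_Loop loop_map_def map_act[OF f] cube_mor_one_tensor cells_Loop)
qed

text \<open>Constant faces at both ends of the loop coordinate complete a box in the loop object to
  a box in \<open>X\<close> one dimension higher, with missing face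
  \<open>(Suc i, \<epsilon>)\<close>.\<close>

lemma box_filling_Loop:
  assumes X: "cubical_set X" and Y: "cubical_set Y" and p: "cubical_map X Y p"
    and x: "x \<in> cells X 0" and fill: "box_filling X Y p"
  shows "box_filling (Loop X x) (Loop Y (p 0 x)) (loop_map p)"
  unfolding box_filling_def
proof (intro allI impI, goal_cases)
  case (1 n i \<epsilon> F y)
  define G where "G j b = (if j = Suc 0 then pt X x (Suc n) else F (j - 1) b)" for j b
  have y: "y \<in> cells Y (Suc (Suc n))" and yb: "bd Y (Suc n) (Suc 0) b y = pt Y (p 0 x) (Suc n)" for b
    using 1(5) bd_first_Loop[OF 1(5)] by (simp_all add: cells_Loop)
  have FL: "F j b \<in> cells (Loop X x) n" "bd (Loop Y (p 0 x)) n j b y = p (Suc n) (F j b)"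
    if "1 \<le> j" "j \<le> Suc n" "(j, b) \<noteq> (i, \<epsilon>)" for j b
    using 1(3)[rule_format, OF that] by (auto simp: loop_map_def)
  have F: "F j b \<in> cells X (Suc n)" "bd X n (Suc 0) c (F j b) = pt X x n"
    "bd Y (Suc n) (Suc j) b y = p (Suc n) (F j b)"
    if "1 \<le> j" "j \<le> Suc n" "(j, b) \<noteq> (i, \<epsilon>)" for j b c
    using FL[OF that] that(1) by (cases c; auto simp: cells_Loop bd_Loop)+
  have "\<exists>z\<in>cells X (Suc (Suc n)). p (Suc (Suc n)) z = y \<and>
    (\<forall>j b. 1 \<le> j \<longrightarrow> j \<le> Suc (Suc n) \<longrightarrow> (j, b) \<noteq> (Suc i, \<epsilon>) \<longrightarrow> bd X (Suc n) j b z = G j b)"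
  proof (rule fill[unfolded box_filling_def, rule_format], goal_cases)
    case (3 j b)
    show ?case
    proof (cases "j = Suc 0")
      case True
      then show ?thesis using yb map_pt[OF p x] by (simp add: G_def pt_cells[OF X x])
    next
      case False
      with 3 have "1 \<le> j - 1" "j - 1 \<le> Suc n" "(j - 1, b) \<noteq> (i, \<epsilon>)" by auto
      from F(1)[OF this] F(3)[OF this] False 3 show ?thesis by (simp add: G_def)
    qed
  next
    case (4 j b k c)
    from 4 have j: "1 \<le> j - 1" "j - 1 \<le> Suc n" "(j - 1, b) \<noteq> (i, \<epsilon>)" by auto
    show ?case
    proof (cases "k = Suc 0")
      case True
      with 4 j F(2)[OF j] show ?thesis by (simp add: G_def bd_pt[OF X x])
    next
      case False
      with 4 have k: "1 \<le> k - 1" "k - 1 \<le> Suc n" "(k - 1, c) \<noteq> (i, \<epsilon>)" "k - 1 < j - 1" by auto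
      then obtain n' where n: "n = Suc n'" using j by (cases n) auto
      have "bd (Loop X x) n' (k - 1) c (F (j - 1) b) = bd (Loop X x) n' (j - 1 - 1) b (F (k - 1) c)"
        using 1(4)[rule_format, of "k - 1" "j - 1" b c] j k n by simp
      moreover have "1 \<le> j - 1 - 1" "Suc (j - Suc (Suc 0)) = j - Suc 0" using k by auto
      ultimately show ?thesis using k j n False 4 by (simp add: G_def bd_Loop)
    qed
  qed (use 1(1,2) y in auto)
  then obtain z where z: "z \<in> cells X (Suc (Suc n))" "p (Suc (Suc n)) z = y"
    and zG: "\<And>j b. 1 \<le> j \<Longrightarrow> j \<le> Suc (Suc n) \<Longrightarrow> (j, b) \<noteq> (Suc i, \<epsilon>) \<Longrightarrow> bd X (Suc n) j b z = G j b"
    by blast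
  show ?case
  proof (rule bexI[of _ z], intro conjI allI impI)
    show "z \<in> cells (Loop X x) (Suc n)"
      using z zG[of "Suc 0"] 1(1) by (simp add: cells_Loop G_def)
    show "loop_map p (Suc n) z = y" using z by (simp add: loop_map_def)
    fix j b assume "1 \<le> j" "j \<le> Suc n" "(j, b) \<noteq> (i, \<epsilon>)"
    then show "bd (Loop X x) n j b z = F j b"
      using zG[of "Suc j" b] by (simp add: bd_Loop G_def)
  qed
qed

lemma Loop_triv: "Loop triv () = triv"
  by (rule cset.equality)
    (auto simp: Loop_def loop_def fiber_def path_cset_def path_ends_def prod_cset_def point_def triv_def fun_eq_iff)

text \<open>Looping the map to \<open>triv\<close> gives the map to \<open>triv\<close> again, so
  the absolute case is an instance of the relative one.\<close>

lemma kan_Loop: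
  assumes "kan X" "x \<in> cells X 0"
  shows "kan (Loop X x)"
proof -
  have "cubical_map X triv (\<lambda>_ _. ())" by (simp add: cubical_map_def)
  moreover have "loop_map (\<lambda>(_ :: nat) (_ :: 'a). ()) = (\<lambda>_ _. ())"
    by (simp add: loop_map_def fun_eq_iff)
  ultimately show ?thesis
    using assms box_filling_Loop[of X triv "\<lambda>_ _. ()" x] cubical_set_Loop[of X x]
    by (simp add: kan_def cubical_set_triv Loop_triv)
qed

subsection \<open>The fundamental group\<close>

lemma Loop_edge: "cubical_set X \<Longrightarrow> x \<in> cells X 0 \<Longrightarrow> g \<in> cells (Loop X x) 0 \<longleftrightarrow> edge X g x x"
  by (auto simp: cells_Loop edge_def pt_0)

text \<open>The loop coordinate comes first, so the constancy conditions concern the left and right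
  faces.\<close>

lemma path_rel_Loop:
  assumes X: "cubical_set X" and x: "x \<in> cells X 0"
  shows "path_rel (Loop X x) g h \<longleftrightarrow> Sq X (pt X x (Suc 0)) (pt X x (Suc 0)) g h"
  by (auto simp: path_rel_def edge_def Sq_def square_def cells_Loop bd_Loop numeral_2_eq_2)

lemma loop_class_eq:
  assumes X: "kan X" and x: "x \<in> cells X 0" and "edge X g x x" "edge X h x x"
  shows "pi0_class (Loop X x) 0 g = pi0_class (Loop X x) 0 h \<longleftrightarrow> Sq X (pt X x (Suc 0)) (pt X x (Suc 0)) g h"
proof -
  have c: "cubical_set X" using X by (simp add: kan_def)
  show ?thesis
    using pi0_class_eq_path[OF kan_Loop[OF X x]] assms(3,4)
    by (simp add: path_rel_Loop[OF c x] Loop_edge[OF c x])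
qed

lemma Sq_edges:
  assumes "cubical_set X" "Sq X l r b t"
  shows "b \<in> cells X (Suc 0)"
    and "bd X 0 (Suc 0) False b = bd X 0 (Suc 0) False l" "bd X 0 (Suc 0) True b = bd X 0 (Suc 0) False r"
  using assms square_edges[OF assms(1)] by (auto simp: Sq_def edge_def)

text \<open>A square with left face \<open>g\<close>, top \<open>h\<close>, constant right face and bottom \<open>k\<close> exhibits \<open>k\<close> as the
  product of \<open>g\<close> and \<open>h\<close>.\<close>

lemma pi1_mult_class:
  assumes X: "kan X" and x: "x \<in> cells X 0" and g: "edge X g x x" and h: "edge X h x x"
    and sq: "Sq X g (pt X x (Suc 0)) k h"
  shows "pi1_mult (X, x) (pi0_class (Loop X x) 0 g) (pi0_class (Loop X x) 0 h) = pi0_class (Loop X x) 0 k"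
proof -
  have c: "cubical_set X" using X by (simp add: kan_def)
  define e where "e = pt X x (Suc 0)"
  have e: "edge X e x x" using edge_pt[OF c x] by (simp add: e_def)
  have k: "edge X k' x x" if "Sq X g' e k' h'" "edge X g' x x" for g' h' k'
    using Sq_edges[OF c that(1)] that(2) e by (simp add: edge_def)
  let ?P = "\<lambda>C. \<exists>g' h' s. g' \<in> cells (Loop X x) 0 \<and> h' \<in> cells (Loop X x) 0 \<and>
       pi0_class (Loop X x) 0 g = pi0_class (Loop X x) 0 g' \<and> pi0_class (Loop X x) 0 h = pi0_class (Loop X x) 0 h' \<and>
       s \<in> cells X 2 \<and> act X 1 2 (face 1 1 False) s = g' \<and> act X 1 2 (face 1 2 True) s = h' \<and>
       act X 1 2 (face 1 1 True) s = act X 1 0 (degen 0 1) x \<and>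
       C = pi0_class (Loop X x) 0 (act X 1 2 (face 1 2 False) s)"
  have s: "s \<in> cells X 2 \<and> act X 1 2 (face 1 1 False) s = g' \<and> act X 1 2 (face 1 2 True) s = h' \<and>
       act X 1 2 (face 1 1 True) s = act X 1 0 (degen 0 1) x \<and>
       C = pi0_class (Loop X x) 0 (act X 1 2 (face 1 2 False) s) \<longleftrightarrow>
     (\<exists>k'. square X s g' e k' h' \<and> C = pi0_class (Loop X x) 0 k')" for s g' h' C
    by (auto simp: square_def bd_def numeral_2_eq_2 e_def act_1_0[OF c])
  \<comment> \<open>The predicate under \<open>THE\<close> is rewritten with \<open>Sq\<close>,
    where equality of classes becomes a square with constant sides.\<close>
  have P: "?P C \<longleftrightarrow> (\<exists>g' h' k'. edge X g' x x \<and> edge X h' x x \<and>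
      Sq X e e g g' \<and> Sq X e e h h' \<and> Sq X g' e k' h' \<and> C = pi0_class (Loop X x) 0 k')" for C
  proof
    assume "?P C"
    then obtain g' h' s k' where *: "edge X g' x x" "edge X h' x x"
      "pi0_class (Loop X x) 0 g = pi0_class (Loop X x) 0 g'" "pi0_class (Loop X x) 0 h = pi0_class (Loop X x) 0 h'"
      "square X s g' e k' h'" "C = pi0_class (Loop X x) 0 k'"
      unfolding s Loop_edge[OF c x] by blast
    then have "Sq X e e g g'" "Sq X e e h h'" "Sq X g' e k' h'"
      using loop_class_eq[OF X x g *(1)] loop_class_eq[OF X x h *(2)] by (auto simp: e_def Sq_def)
    with * show "\<exists>g' h' k'. edge X g' x x \<and> edge X h' x x \<and>
      Sq X e e g g' \<and> Sq X e e h h' \<and> Sq X g' e k' h' \<and> C = pi0_class (Loop X x) 0 k'" by blast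
  next
    assume "\<exists>g' h' k'. edge X g' x x \<and> edge X h' x x \<and>
      Sq X e e g g' \<and> Sq X e e h h' \<and> Sq X g' e k' h' \<and> C = pi0_class (Loop X x) 0 k'"
    then obtain g' h' k' where *: "edge X g' x x" "edge X h' x x" "Sq X e e g g'" "Sq X e e h h'"
      "Sq X g' e k' h'" "C = pi0_class (Loop X x) 0 k'" by blast
    then have "pi0_class (Loop X x) 0 g = pi0_class (Loop X x) 0 g'" "pi0_class (Loop X x) 0 h = pi0_class (Loop X x) 0 h'"
      using loop_class_eq[OF X x g *(1)] loop_class_eq[OF X x h *(2)] by (auto simp: e_def)
    with * show "?P C"
      unfolding s Loop_edge[OF c x] Sq_def[of X g'] by blast
  qed
  have deg: "Sq X e e g' g'" if "edge X g' x x" for g'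
    using square_degen_2[OF c that] by (auto simp: Sq_def e_def)
  have uniq: "pi0_class (Loop X x) 0 k' = pi0_class (Loop X x) 0 k"
    if *: "edge X g' x x" "edge X h' x x" "Sq X e e g g'" "Sq X e e h h'" "Sq X g' e k' h'" for g' h' k'
  proof -
    \<comment> \<open>Opposite faces in direction 3 are the two product squares; homotopies from
      \<open>g\<close> to \<open>g'\<close> and from \<open>h\<close> to \<open>h'\<close> join
      them, and the missing face is one from \<open>k\<close> to \<open>k'\<close>.\<close>
    have "Sq X e e k k'"
      by (rule Sq_fill_cube[OF X, of e e g g' e e e e h h'])
        (use * sq deg[OF e] in \<open>simp_all add: e_def\<close>)
    moreover have "edge X k x x" "edge X k' x x" using k sq g * by (auto simp: e_def)
    ultimately show ?thesis using loop_class_eq[OF X x, of k k'] by (simp add: e_def)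
  qed
  have "(THE C. ?P C) = pi0_class (Loop X x) 0 k"
    unfolding P
  proof (rule the_equality)
    show "\<exists>g' h' k'. edge X g' x x \<and> edge X h' x x \<and> Sq X e e g g' \<and> Sq X e e h h' \<and> Sq X g' e k' h' \<and>
        pi0_class (Loop X x) 0 k = pi0_class (Loop X x) 0 k'"
      using g h deg[OF g] deg[OF h] sq by (auto simp: e_def)
  qed (use uniq in blast)
  then show ?thesis by (simp add: pi1_mult_def Loop_def)
qed

lemma Sq_product:
  assumes X: "kan X" and g: "edge X g x x" and h: "edge X h x x"
  obtains k where "edge X k x x" "Sq X g (pt X x (Suc 0)) k h"
proof -
  have c: "cubical_set X" and fill: "box_filling X triv (\<lambda>_ _. ())" using X by (auto simp: kan_def)
  have e: "edge X (pt X x (Suc 0)) x x" using edge_pt[OF c] edge_cells[OF c g] by simp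
  obtain z where "square X z g (pt X x (Suc 0)) (bd X (Suc 0) 2 False z) h"
    by (rule fill_square[OF fill square_triv, of 2 False g x x "pt X x (Suc 0)" x x _ h])
      (use g h e in \<open>auto simp: square_def\<close>)
  then have sq: "Sq X g (pt X x (Suc 0)) (bd X (Suc 0) 2 False z) h" by (auto simp: Sq_def)
  moreover have "edge X (bd X (Suc 0) 2 False z) x x" using Sq_edges[OF c sq] g e by (simp add: edge_def)
  ultimately show thesis using that by blast
qed

lemma group_pi1:
  assumes X: "kan X" and x: "x \<in> cells X 0"
  shows "group (pi1_group (X, x))"
proof -
  have c: "cubical_set X" and fill: "box_filling X triv (\<lambda>_ _. ())" using X by (auto simp: kan_def)
  define cls where "cls = pi0_class (Loop X x) 0"
  define e where "e = pt X x (Suc 0)"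
  have e: "edge X e x x" using edge_pt[OF c x] by (simp add: e_def)
  have carrier: "carrier (pi1_group (X, x)) = {cls g | g. edge X g x x}"
    using pi0_eq_image[OF cubical_set_Loop[OF c x]] Loop_edge[OF c x]
    by (auto simp: pi1_group_def pi_set_def cls_def Loop_def)
  have mult: "cls g \<otimes>\<^bsub>pi1_group (X, x)\<^esub> cls h = cls k"
    if "edge X g x x" "edge X h x x" "Sq X g e k h" for g h k
    using pi1_mult_class[OF X x that(1,2)] that(3) by (simp add: pi1_group_def cls_def e_def)
  have one: "\<one>\<^bsub>pi1_group (X, x)\<^esub> = cls e"
    using loop_eq[OF c] by (simp add: pi1_group_def pi_base_def cls_def e_def)
  have ex: "\<exists>k. edge X k x x \<and> Sq X g e k h" if "edge X g x x" "edge X h x x" for g h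
    using Sq_product[OF X that] unfolding e_def by blast
  have deg1: "Sq X g g e e" and deg2: "Sq X e e g g" if "edge X g x x" for g
    using square_degen_1[OF c that] square_degen_2[OF c that] by (auto simp: Sq_def e_def)
  show ?thesis
  proof (rule groupI)
    fix a b assume "a \<in> carrier (pi1_group (X, x))" "b \<in> carrier (pi1_group (X, x))"
    then obtain g h where gh: "edge X g x x" "edge X h x x" "a = cls g" "b = cls h"
      by (auto simp: carrier)
    with ex[OF gh(1,2)] mult[OF gh(1,2)] show "a \<otimes>\<^bsub>pi1_group (X, x)\<^esub> b \<in> carrier (pi1_group (X, x))"
      by (auto simp: carrier)
  next
    show "\<one>\<^bsub>pi1_group (X, x)\<^esub> \<in> carrier (pi1_group (X, x))" using e by (auto simp: one carrier)
  next
    fix a b d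
    assume "a \<in> carrier (pi1_group (X, x))" "b \<in> carrier (pi1_group (X, x))" "d \<in> carrier (pi1_group (X, x))"
    then obtain f g k where fgk: "edge X f x x" "edge X g x x" "edge X k x x" "a = cls f" "b = cls g" "d = cls k"
      by (auto simp: carrier)
    obtain h m where h: "edge X h x x" "Sq X f e h g" and m: "edge X m x x" "Sq X g e m k"
      using ex fgk by blast
    obtain l where l: "edge X l x x" "Sq X h e l k" using ex h(1) fgk(3) by blast
    \<comment> \<open>The faces say \<open>f g = h\<close>, \<open>h k = l\<close> and
      \<open>g k = m\<close>; the remaining one says \<open>f m = l\<close>.\<close>
    have "Sq X f e l m"
      by (rule Sq_fill_cube[OF X h(2) deg2[OF e] deg2[OF fgk(3)] l(2) m(2)])
    then show "a \<otimes>\<^bsub>pi1_group (X, x)\<^esub> b \<otimes>\<^bsub>pi1_group (X, x)\<^esub> d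
      = a \<otimes>\<^bsub>pi1_group (X, x)\<^esub> (b \<otimes>\<^bsub>pi1_group (X, x)\<^esub> d)"
      using mult fgk h m l by simp
  next
    fix a assume "a \<in> carrier (pi1_group (X, x))"
    then obtain g where g: "edge X g x x" "a = cls g" by (auto simp: carrier)
    then show "\<one>\<^bsub>pi1_group (X, x)\<^esub> \<otimes>\<^bsub>pi1_group (X, x)\<^esub> a = a"
      using mult[OF e g(1) deg2[OF g(1)]] by (simp add: one)
    \<comment> \<open>The left face is open. With top \<open>g\<close>, constant bottom and constant
      right face, it is a left inverse of \<open>g\<close>; \<open>groupI\<close> asks for inverses
      on the left only.\<close>
    obtain z where z: "square X z (bd X (Suc 0) (Suc 0) False z) e e g"
      by (rule fill_square[OF fill square_triv, of "Suc 0" False _ x x e x x e g])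
        (use g e in \<open>auto simp: square_def\<close>)
    let ?h = "bd X (Suc 0) (Suc 0) False z"
    have h: "edge X ?h x x" using square_edges(1)[OF c z] e g by (simp add: edge_def)
    have "cls ?h \<otimes>\<^bsub>pi1_group (X, x)\<^esub> a = \<one>\<^bsub>pi1_group (X, x)\<^esub>"
      using mult[OF h g(1)] z g by (auto simp: one Sq_def)
    then show "\<exists>b\<in>carrier (pi1_group (X, x)). b \<otimes>\<^bsub>pi1_group (X, x)\<^esub> a = \<one>\<^bsub>pi1_group (X, x)\<^esub>"
      using h by (auto simp: carrier)
  qed
qed

subsection \<open>Fiber sequences\<close>

text \<open>A relation rather than a function, since \<open>p\<close> determines neither a lift nor
  its start vertex.\<close>

definition transgress ::
  "'c cset \<Rightarrow> 'a cset \<Rightarrow> 'a \<Rightarrow> (nat \<Rightarrow> 'c \<Rightarrow> 'a) \<Rightarrow> (nat \<Rightarrow> 'a \<Rightarrow> 'b) \<Rightarrow> 'b \<Rightarrow> 'c \<Rightarrow> bool" where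
  "transgress A X x i f p w \<longleftrightarrow> w \<in> cells A 0 \<and> (\<exists>t. edge X t (i 0 w) x \<and> f (Suc 0) t = p)"

definition connecting ::
  "'c cset \<Rightarrow> 'a cset \<Rightarrow> 'a \<Rightarrow> 'b cset \<Rightarrow> 'b \<Rightarrow> (nat \<Rightarrow> 'c \<Rightarrow> 'a) \<Rightarrow> (nat \<Rightarrow> 'a \<Rightarrow> 'b) \<Rightarrow>
   (nat \<times> 'b) set \<Rightarrow> (nat \<times> 'c) set" where
  "connecting A X x Y y i f C = (THE D. \<exists>p w. edge Y p y y \<and> C = pi0_class (Loop Y y) 0 p \<and>
     transgress A X x i f p w \<and> D = pi0_class A 0 w)"

text \<open>The fiber is described by \<open>i_inj\<close>, \<open>fi\<close> and
  \<open>fiber_ex\<close> instead of \<open>is_pullback\<close>: the loop object of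
  \<open>cube 0\<close> is not \<open>cube 0\<close>, whereas these conditions pass to loop objects
  unchanged.\<close>

locale fiber_sequence =
  fixes A :: "'c cset" and a :: 'c and X :: "'a cset" and x :: 'a and Y :: "'b cset" and y :: 'b
    and i :: "nat \<Rightarrow> 'c \<Rightarrow> 'a" and f :: "nat \<Rightarrow> 'a \<Rightarrow> 'b"
  assumes A: "cubical_set A" and kan_X: "kan X" and kan_Y: "kan Y"
    and a: "a \<in> cells A 0"
    and i: "cubical_map A X i" and f: "cubical_map X Y f"
    and ia: "i 0 a = x" and fx: "f 0 x = y"
    and fill: "box_filling X Y f"
    and i_inj: "\<And>n w w'. w \<in> cells A n \<Longrightarrow> w' \<in> cells A n \<Longrightarrow> i n w = i n w' \<Longrightarrow> w = w'"
    and fi: "\<And>n w. w \<in> cells A n \<Longrightarrow> f n (i n w) = pt Y y n"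
    and fiber_ex: "\<And>n z. z \<in> cells X n \<Longrightarrow> f n z = pt Y y n \<Longrightarrow> \<exists>w\<in>cells A n. i n w = z"
begin

lemma X: "cubical_set X" and Y: "cubical_set Y"
  using kan_X kan_Y by (auto simp: kan_def)

lemma x: "x \<in> cells X 0" and y: "y \<in> cells Y 0"
  using map_cells[OF i a] map_cells[OF f, of x 0] by (auto simp: ia fx)

text \<open>A box in the fiber is lifted over a constant cube of \<open>Y\<close>; the filler lies
  in the fiber, and injectivity of \<open>i\<close> identifies its faces.\<close>

lemma kan_A: "kan A"
proof -
  have "box_filling A triv (\<lambda>_ _. ())"
    unfolding box_filling_def
  proof (intro allI impI, goal_cases)
    case (1 n k \<epsilon> F u)
    have FA: "F j b \<in> cells A n" if "1 \<le> j" "j \<le> Suc n" "(j, b) \<noteq> (k, \<epsilon>)" for j b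
      using 1(3) that by blast
    have "\<exists>z\<in>cells X (Suc n). f (Suc n) z = pt Y y (Suc n) \<and>
      (\<forall>j b. 1 \<le> j \<longrightarrow> j \<le> Suc n \<longrightarrow> (j, b) \<noteq> (k, \<epsilon>) \<longrightarrow> bd X n j b z = i n (F j b))"
    proof (rule fill[unfolded box_filling_def, rule_format], goal_cases)
      case (3 j b)
      then show ?case
        using FA[OF 3] by (simp add: fi map_cells[OF i] bd_pt[OF Y y])
    next
      case (4 j b l c)
      then obtain m where n: "n = Suc m" by (cases n) auto
      have "F j b \<in> cells A (Suc m)" "F l c \<in> cells A (Suc m)"
        using 4 n FA[of j b] FA[of l c] by auto
      moreover have "bd A m l c (F j b) = bd A m (j - 1) b (F l c)"
        using 1(4)[rule_format, OF 4] n by simp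
      ultimately show ?case
        using map_bd[OF i, of "F j b" m l c] map_bd[OF i, of "F l c" m "j - 1" b] 4 n by simp
    qed (use 1(1,2) pt_cells[OF Y y] in auto)
    then obtain z where z: "z \<in> cells X (Suc n)" "f (Suc n) z = pt Y y (Suc n)"
      and zF: "\<And>j b. 1 \<le> j \<Longrightarrow> j \<le> Suc n \<Longrightarrow> (j, b) \<noteq> (k, \<epsilon>) \<Longrightarrow> bd X n j b z = i n (F j b)"
      by blast
    obtain w where w: "w \<in> cells A (Suc n)" "i (Suc n) w = z" using fiber_ex[OF z] by blast
    have "bd A n j b w = F j b" if "1 \<le> j" "j \<le> Suc n" "(j, b) \<noteq> (k, \<epsilon>)" for j b
      using that w zF[OF that] FA[OF that] map_bd[OF i w(1), of j b]
      by (intro i_inj[OF bd_cells[OF A w(1)]]) auto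
    with w(1) show ?case by auto
  qed
  with A show ?thesis by (simp add: kan_def)
qed

lemma fiber_sequence_Loop:
  "fiber_sequence (Loop A a) (pt A a (Suc 0)) (Loop X x) (pt X x (Suc 0)) (Loop Y y) (pt Y y (Suc 0))
     (loop_map i) (loop_map f)"
proof
  show "cubical_set (Loop A a)" by (rule cubical_set_Loop[OF A a])
  show "kan (Loop X x)" by (rule kan_Loop[OF kan_X x])
  show "kan (Loop Y y)" by (rule kan_Loop[OF kan_Y y])
  show "pt A a (Suc 0) \<in> cells (Loop A a) 0" by (rule pt_cells_Loop[OF A a])
  show "cubical_map (Loop A a) (Loop X x) (loop_map i)" using cubical_map_Loop[OF i a] by (simp add: ia)
  show "cubical_map (Loop X x) (Loop Y y) (loop_map f)" using cubical_map_Loop[OF f x] by (simp add: fx)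
  show "loop_map i 0 (pt A a (Suc 0)) = pt X x (Suc 0)" using map_pt[OF i a] by (simp add: loop_map_def ia)
  show "loop_map f 0 (pt X x (Suc 0)) = pt Y y (Suc 0)" using map_pt[OF f x] by (simp add: loop_map_def fx)
  show "box_filling (Loop X x) (Loop Y y) (loop_map f)" using box_filling_Loop[OF X Y f x fill] by (simp add: fx)
next
  fix n w w' assume "w \<in> cells (Loop A a) n" "w' \<in> cells (Loop A a) n" "loop_map i n w = loop_map i n w'"
  then show "w = w'" using i_inj[of w "Suc n" w'] by (simp add: cells_Loop loop_map_def)
next
  fix n w assume "w \<in> cells (Loop A a) n"
  then show "loop_map f n (loop_map i n w) = pt (Loop Y y) (pt Y y (Suc 0)) n"
    by (simp add: cells_Loop loop_map_def fi pt_Loop[OF Y y])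
next
  fix n z assume z: "z \<in> cells (Loop X x) n" and fz: "loop_map f n z = pt (Loop Y y) (pt Y y (Suc 0)) n"
  then obtain w where w: "w \<in> cells A (Suc n)" "i (Suc n) w = z"
    using fiber_ex[of z "Suc n"] by (auto simp: cells_Loop loop_map_def pt_Loop[OF Y y])
  \<comment> \<open>The faces of \<open>w\<close> are recognised by their images under the injective
    \<open>i\<close>.\<close>
  have "bd A n (Suc 0) b w = pt A a n" for b
    using map_bd[OF i w(1), of "Suc 0" b] w(2) bd_first_Loop[OF z] map_pt[OF i a, of n]
    by (intro i_inj[OF bd_cells[OF A w(1)] pt_cells[OF A a]]) (auto simp: ia)
  with w show "\<exists>w\<in>cells (Loop A a) n. loop_map i n w = z" by (auto simp: cells_Loop loop_map_def)
qed

lemma edge_fiber: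
  assumes "edge X e (i 0 u) (i 0 v)" "f (Suc 0) e = pt Y y (Suc 0)" "u \<in> cells A 0" "v \<in> cells A 0"
  obtains g where "edge A g u v" "i (Suc 0) g = e"
proof -
  obtain g where g: "g \<in> cells A (Suc 0)" "i (Suc 0) g = e"
    using fiber_ex[of e "Suc 0"] assms by (auto simp: edge_def)
  have "bd A 0 (Suc 0) b g = (if b then v else u)" for b
    using assms g map_bd[OF i g(1), of "Suc 0" b]
    by (intro i_inj[OF bd_cells[OF A g(1)]]) (auto simp: edge_def)
  from this[of True] this[of False] g that show thesis by (auto simp: edge_def)
qed

lemma square_fiber:
  assumes "square X z (i (Suc 0) l) (i (Suc 0) r) (i (Suc 0) b) (i (Suc 0) t)" "f (Suc (Suc 0)) z = pt Y y (Suc (Suc 0))"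
    and lrbt: "l \<in> cells A (Suc 0)" "r \<in> cells A (Suc 0)" "b \<in> cells A (Suc 0)" "t \<in> cells A (Suc 0)"
  shows "Sq A l r b t"
proof -
  obtain g where g: "g \<in> cells A (Suc (Suc 0))" "i (Suc (Suc 0)) g = z"
    using fiber_ex[of z "Suc (Suc 0)"] assms by (auto simp: square_def)
  have face: "bd A (Suc 0) j \<epsilon> g = w" if "j = Suc 0 \<or> j = 2" "w \<in> cells A (Suc 0)" "bd X (Suc 0) j \<epsilon> z = i (Suc 0) w" for j \<epsilon> w
    using that g map_bd[OF i g(1), of j \<epsilon>]
    by (intro i_inj[OF bd_cells[OF A g(1)]]) auto
  have "square A g l r b t" using assms g face by (simp add: square_def)
  then show ?thesis by (auto simp: Sq_def)
qed

section \<open>The connecting map and exactness\<close>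

abbreviation "trg \<equiv> transgress A X x i f"
abbreviation "delta \<equiv> connecting A X x Y y i f"
abbreviation "cls \<equiv> pi0_class (Loop Y y) 0"

lemma trg_ex:
  assumes "edge Y p y y"
  obtains w where "trg p w"
proof -
  obtain t where t: "t \<in> cells X (Suc 0)" "f (Suc 0) t = p" "bd X 0 (Suc 0) True t = x"
    by (rule fill_edge[OF fill assms, of x True]) (use fx x in auto)
  have "f 0 (bd X 0 (Suc 0) False t) = pt Y y 0"
    using map_bd[OF f t(1), of "Suc 0" False] t(2) assms by (simp add: edge_def pt_0[OF Y y])
  then obtain w where "w \<in> cells A 0" "i 0 w = bd X 0 (Suc 0) False t"
    using fiber_ex[OF bd_cells[OF X t(1)]] by auto
  with t show thesis
    by (intro that[of w]) (auto simp: transgress_def edge_def intro!: exI[of _ t])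
qed

text \<open>The square in \<open>Y\<close> is lifted with the two given lifts as bottom and top and
  a constant right face. The open left face lies over a constant side, so it is a path in the
  fiber.\<close>

lemma trg_unique:
  assumes "trg p w" "trg p' w'" and sq: "Sq Y (pt Y y (Suc 0)) (pt Y y (Suc 0)) p p'"
  shows "path_rel A w w'"
proof -
  obtain t t' where t: "edge X t (i 0 w) x" "f (Suc 0) t = p" "edge X t' (i 0 w') x" "f (Suc 0) t' = p'"
    and w: "w \<in> cells A 0" "w' \<in> cells A 0"
    using assms by (auto simp: transgress_def)
  obtain s where s: "square Y s (pt Y y (Suc 0)) (pt Y y (Suc 0)) p p'" using sq by (auto simp: Sq_def)
  obtain z where z: "f (Suc (Suc 0)) z = s" "square X z (bd X (Suc 0) (Suc 0) False z) (pt X x (Suc 0)) t t'"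
    by (rule fill_square[OF fill s, of "Suc 0" False _ "i 0 w" "i 0 w'" "pt X x (Suc 0)" x x t t'])
      (use t edge_pt[OF X x] map_pt[OF f x] fx in \<open>auto simp: square_def\<close>)
  have "edge X (bd X (Suc 0) (Suc 0) False z) (i 0 w) (i 0 w')"
    using square_edges(1)[OF X z(2)] t by (simp add: edge_def)
  moreover have "f (Suc 0) (bd X (Suc 0) (Suc 0) False z) = pt Y y (Suc 0)"
    using square_map[OF f z(2)] z(1) s by (simp add: square_def)
  ultimately show ?thesis using edge_fiber[OF _ _ w] by (auto simp: path_rel_def)
qed

text \<open>Evaluates the description in \<open>connecting\<close> from any representative and any
  lift.\<close>

lemma delta_class:
  assumes p: "edge Y p y y" and w: "trg p w"
  shows "delta (cls p) = pi0_class A 0 w"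
  unfolding connecting_def
proof (rule the_equality)
  fix D assume "\<exists>q v. edge Y q y y \<and> cls p = cls q \<and> trg q v \<and> D = pi0_class A 0 v"
  then obtain q v where q: "edge Y q y y" "cls p = cls q" "trg q v" "D = pi0_class A 0 v" by blast
  have "path_rel A w v" using trg_unique[OF w q(3)] loop_class_eq[OF kan_Y y p q(1)] q(2) by simp
  then show "D = pi0_class A 0 w"
    using pi0_class_eq_path[OF kan_A, of w v] w q(3,4) by (simp add: transgress_def)
qed (use assms in blast)

lemma loop_classE:
  assumes "C \<in> pi0 (Loop Y y)"
  obtains p where "edge Y p y y" "C = cls p"
  using assms pi0_eq_image[OF cubical_set_Loop[OF Y y]] Loop_edge[OF Y y] by auto

lemma loop_class_mem: "edge Y p y y \<Longrightarrow> cls p \<in> pi0 (Loop Y y)"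
  using pi0_eq_image[OF cubical_set_Loop[OF Y y]] Loop_edge[OF Y y] by auto

lemma delta_mem: "C \<in> pi0 (Loop Y y) \<Longrightarrow> delta C \<in> pi0 A"
  by (metis loop_classE trg_ex delta_class transgress_def pi0_eq_image[OF A] imageI)

text \<open>A loop in \<open>X\<close> is its own lift, and it starts at \<open>x\<close>, the image
  of \<open>a\<close>.\<close>

lemma trg_image:
  assumes "edge X t x x"
  shows "trg (f (Suc 0) t) a"
  using assms a ia by (auto simp: transgress_def)

lemma delta_base: "delta (cls (pt Y y (Suc 0))) = pi0_class A 0 a"
  using delta_class[OF edge_pt[OF Y y], of a] trg_image[OF edge_pt[OF X x]] map_pt[OF f x] fx by simp

lemma exact_pi1_Y:
  "exact_at (pi0 (Loop X x)) (pi0_map (Loop Y y) (loop_map f)) (pi0 (Loop Y y)) delta (pi0_class A 0 a)"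
proof -
  have f_class: "pi0_map (Loop Y y) (loop_map f) (pi0_class (Loop X x) 0 q) = cls (f (Suc 0) q)"
    if "edge X q x x" for q
    using pi0_map_class[OF cubical_set_Loop[OF X x] cubical_map_Loop[OF f x], of q 0] that
    by (simp add: Loop_edge[OF X x] fx loop_map_def)
  have f_edge: "edge Y (f (Suc 0) q) y y" if "edge X q x x" for q
    using edge_map[OF f that] by (simp add: fx)
  show ?thesis
    unfolding exact_at_def
  proof (intro equalityI subsetI)
    fix C assume "C \<in> pi0_map (Loop Y y) (loop_map f) ` pi0 (Loop X x)"
    then obtain q where q: "edge X q x x" "C = cls (f (Suc 0) q)"
      using pi0_eq_image[OF cubical_set_Loop[OF X x]] Loop_edge[OF X x] f_class by auto
    then show "C \<in> {s \<in> pi0 (Loop Y y). delta s = pi0_class A 0 a}"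
      using delta_class[OF f_edge trg_image] loop_class_mem[OF f_edge] by simp
  next
    fix C assume "C \<in> {s \<in> pi0 (Loop Y y). delta s = pi0_class A 0 a}"
    then obtain p where p: "edge Y p y y" "C = cls p" and C: "delta C = pi0_class A 0 a"
      by (auto elim: loop_classE)
    obtain w where w: "trg p w" using trg_ex[OF p(1)] .
    then obtain t where t: "w \<in> cells A 0" "edge X t (i 0 w) x" "f (Suc 0) t = p" by (auto simp: transgress_def)
    have "path_rel A w a"
      using delta_class[OF p(1) w] C p(2) pi0_class_eq_path[OF kan_A t(1) a] by simp
    then obtain e where e: "edge A e w a" by (auto simp: path_rel_def)
    have fe: "f (Suc 0) (i (Suc 0) e) = pt Y y (Suc 0)" using e by (simp add: edge_def fi)
    text \<open>Transport \<open>t\<close> along \<open>e\<close> over the square that is constant in the second direction.\<close>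
    obtain z where z: "f (Suc (Suc 0)) z = act Y (Suc (Suc 0)) (Suc 0) (degen (Suc 0) 2) p"
      "square X z (i (Suc 0) e) (pt X x (Suc 0)) t (bd X (Suc 0) 2 True z)"
      by (rule fill_square[OF fill square_degen_2[OF Y p(1)], of 2 True "i (Suc 0) e" "i 0 w" x "pt X x (Suc 0)" x x t _])
        (use t edge_map[OF i e] edge_pt[OF X x] map_pt[OF f x] fx fe ia in \<open>auto simp: square_def\<close>)
    have "edge X (bd X (Suc 0) 2 True z) x x"
      using Sq_edges[OF X, of "i (Suc 0) e"] square_edges[OF X z(2)] edge_map[OF i e] edge_pt[OF X x] ia
      by (simp add: edge_def)
    moreover have "f (Suc 0) (bd X (Suc 0) 2 True z) = p"
      using square_map[OF f z(2)] z(1) square_degen_2[OF Y p(1)] by (simp add: square_def)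
    ultimately show "C \<in> pi0_map (Loop Y y) (loop_map f) ` pi0 (Loop X x)"
      using f_class[of "bd X (Suc 0) 2 True z"] p(2) pi0_eq_image[OF cubical_set_Loop[OF X x]] Loop_edge[OF X x]
      by (metis imageI)
  qed
qed

text \<open>A lift of a loop at \<open>y\<close> is a path from the image of \<open>w\<close> to
  \<open>x\<close>. Conversely such a path projects to a loop at \<open>y\<close> of which it is a
  lift.\<close>

lemma exact_pi0_A: "exact_at (pi0 (Loop Y y)) delta (pi0 A) (pi0_map X i) (pi0_class X 0 x)"
  unfolding exact_at_def
proof (intro equalityI subsetI)
  fix C assume "C \<in> delta ` pi0 (Loop Y y)"
  then obtain p where p: "edge Y p y y" "C = delta (cls p)" by (auto elim: loop_classE)
  obtain w where w: "trg p w" using trg_ex[OF p(1)] .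
  then have w0: "w \<in> cells A 0" and "path_rel X (i 0 w) x" by (auto simp: transgress_def path_rel_def)
  then have "pi0_map X i (pi0_class A 0 w) = pi0_class X 0 x"
    using pi0_map_class[OF A i w0] pi0_class_eq_path[OF kan_X map_cells[OF i w0] x] by simp
  then show "C \<in> {s \<in> pi0 A. pi0_map X i s = pi0_class X 0 x}"
    using delta_class[OF p(1) w] p(2) w0 pi0_eq_image[OF A] by simp
next
  fix C assume "C \<in> {s \<in> pi0 A. pi0_map X i s = pi0_class X 0 x}"
  then obtain w where w: "w \<in> cells A 0" "C = pi0_class A 0 w" and "pi0_map X i C = pi0_class X 0 x"
    using pi0_eq_image[OF A] by auto
  then have "path_rel X (i 0 w) x"
    using pi0_map_class[OF A i w(1)] pi0_class_eq_path[OF kan_X map_cells[OF i w(1)] x] by simp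
  then obtain t where t: "edge X t (i 0 w) x" by (auto simp: path_rel_def)
  have p: "edge Y (f (Suc 0) t) y y"
    using edge_map[OF f t] fi[OF w(1)] by (simp add: fx pt_0[OF Y y])
  have "delta (cls (f (Suc 0) t)) = C"
    using delta_class[OF p, of w] t w by (auto simp: transgress_def)
  then show "C \<in> delta ` pi0 (Loop Y y)" using loop_class_mem[OF p] by blast
qed

text \<open>A path in \<open>Y\<close> from the image of \<open>v\<close> to \<open>y\<close> is
  lifted from its start \<open>v\<close>; the end of the lift lies in the fiber and in the component
  of \<open>v\<close>.\<close>

lemma exact_pi0_X: "exact_at (pi0 A) (pi0_map X i) (pi0 X) (pi0_map Y f) (pi0_class Y 0 y)"
  unfolding exact_at_def
proof (intro equalityI subsetI)
  fix C assume "C \<in> pi0_map X i ` pi0 A"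
  then obtain w where w: "w \<in> cells A 0" "C = pi0_class X 0 (i 0 w)"
    using pi0_eq_image[OF A] pi0_map_class[OF A i] by auto
  then show "C \<in> {s \<in> pi0 X. pi0_map Y f s = pi0_class Y 0 y}"
    using pi0_eq_image[OF X] map_cells[OF i w(1)] pi0_map_class[OF X f map_cells[OF i w(1)]] fi[OF w(1)]
    by (simp add: pt_0[OF Y y])
next
  fix C assume "C \<in> {s \<in> pi0 X. pi0_map Y f s = pi0_class Y 0 y}"
  then obtain v where v: "v \<in> cells X 0" "C = pi0_class X 0 v" and "pi0_map Y f C = pi0_class Y 0 y"
    using pi0_eq_image[OF X] by auto
  then have "path_rel Y (f 0 v) y"
    using pi0_map_class[OF X f v(1)] pi0_class_eq_path[OF kan_Y map_cells[OF f v(1)] y] by simp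
  then obtain p where p: "edge Y p (f 0 v) y" by (auto simp: path_rel_def)
  obtain t where t: "t \<in> cells X (Suc 0)" "f (Suc 0) t = p" "bd X 0 (Suc 0) False t = v"
    by (rule fill_edge[OF fill p, of v False]) (use v in auto)
  have v': "bd X 0 (Suc 0) True t \<in> cells X 0" using bd_cells[OF X t(1)] by simp
  have "f 0 (bd X 0 (Suc 0) True t) = pt Y y 0"
    using map_bd[OF f t(1), of "Suc 0" True] t(2) p by (simp add: edge_def pt_0[OF Y y])
  then obtain w where w: "w \<in> cells A 0" "i 0 w = bd X 0 (Suc 0) True t" using fiber_ex[OF v'] by blast
  have "path_rel X v (i 0 w)" using t w by (auto simp: path_rel_def edge_def)
  then have "C = pi0_map X i (pi0_class A 0 w)"
    using pi0_map_class[OF A i w(1)] pi0_class_eq_path[OF kan_X v(1) map_cells[OF i w(1)]] v(2) by simp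
  then show "C \<in> pi0_map X i ` pi0 A" using w(1) pi0_eq_image[OF A] by auto
qed

section \<open>The connecting map and products\<close>

lemma edge_Loop_square: "edge (Loop Z z) t u v \<longleftrightarrow> square Z t (pt Z z (Suc 0)) (pt Z z (Suc 0)) u v"
  by (auto simp: edge_def square_def cells_Loop bd_Loop numeral_2_eq_2)

text \<open>Two lifts: the cube \<open>W\<close> exhibiting \<open>[P][Q] = [R]\<close> is lifted with faces \<open>TQ\<close> and \<open>TR\<close>, which
  gives a second lift \<open>T\<close> of \<open>P\<close> with horizontal edges \<open>w\<close> and \<open>v\<close>. A connection on \<open>P\<close> is then
  lifted with faces \<open>TP\<close> and \<open>T\<close>; its remaining face lies in the fiber and exhibits \<open>[u][v] = [w]\<close>.\<close>

lemma transgress_mult: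
  assumes W: "square (Loop Y y) W P (pt Y y (Suc (Suc 0))) R Q"
    and P: "square Y P (pt Y y (Suc 0)) (pt Y y (Suc 0)) (pt Y y (Suc 0)) (pt Y y (Suc 0))"
    and TP: "square X TP (pt X x (Suc 0)) (pt X x (Suc 0)) (i (Suc 0) u) (pt X x (Suc 0))" "f (Suc (Suc 0)) TP = P"
    and TQ: "square X TQ (pt X x (Suc 0)) (pt X x (Suc 0)) (i (Suc 0) v) (pt X x (Suc 0))" "f (Suc (Suc 0)) TQ = Q"
    and TR: "square X TR (pt X x (Suc 0)) (pt X x (Suc 0)) (i (Suc 0) w) (pt X x (Suc 0))" "f (Suc (Suc 0)) TR = R"
    and uvw: "edge A u a a" "edge A v a a" "edge A w a a"
  shows "Sq A u (pt A a (Suc 0)) w v"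
proof -
  define e where "e = pt X x (Suc 0)"
  define K where "K = pt X x (Suc (Suc 0))"
  have K: "square X K e e e e" unfolding K_def e_def by (rule square_pt[OF X x])
  have fK: "f (Suc (Suc 0)) K = pt Y y (Suc (Suc 0))" using map_pt[OF f x] by (simp add: K_def fx)
  have WL: "W \<in> cells (Loop Y y) (Suc (Suc 0))" using W by (simp add: square_def)
  have WY: "W \<in> cells Y (Suc (Suc (Suc 0)))" using WL by (simp add: cells_Loop)
  have W1: "bd Y (Suc (Suc 0)) (Suc 0) b W = pt Y y (Suc (Suc 0))" for b by (rule bd_first_Loop[OF WL])
  \<comment> \<open>In \<open>Y\<close> the loop coordinate is 1, so the faces of \<open>W\<close>
    as a square of the loop object move to directions 2 and 3.\<close>
  have W2: "bd Y (Suc (Suc 0)) 2 False W = P" "bd Y (Suc (Suc 0)) 2 True W = pt Y y (Suc (Suc 0))"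
    and W3: "bd Y (Suc (Suc 0)) 3 False W = R" "bd Y (Suc (Suc 0)) 3 True W = Q"
    using W by (simp_all add: square_def bd_Loop numeral_2_eq_2 numeral_3_eq_3)
  \<comment> \<open>A box over \<open>W\<close> with face \<open>(2, False)\<close> open, the one
    over \<open>P\<close>.\<close>
  define F where "F j \<eta> = (if j = (3 :: nat) then if \<eta> then TQ else TR else K)" for j \<eta>
  obtain z where z: "z \<in> cells X (Suc (Suc (Suc 0)))" "f (Suc (Suc (Suc 0))) z = W"
    "shell X (\<lambda>j \<eta>. bd X (Suc (Suc 0)) j \<eta> z)
      (\<lambda>\<beta> \<gamma>. if \<beta> then e else if \<gamma> then i (Suc 0) v else i (Suc 0) w) (\<lambda>_ _. e) (\<lambda>_ _. e) 2 False"
  proof (rule fill_cube[OF X fill WY, of 2 False F "\<lambda>\<beta> \<gamma>. if \<beta> then e else if \<gamma> then i (Suc 0) v else i (Suc 0) w"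
        "\<lambda>_ _. e" "\<lambda>_ _. e"], goal_cases)
    case (2 j \<eta>)
    then show ?case using K TQ TR W1 W2 W3 fK by (cases \<eta>) (auto simp: shell_def F_def e_def)
  qed auto
  define T where "T = bd X (Suc (Suc 0)) 2 False z"
  \<comment> \<open>Along the second coordinate \<open>T\<close> runs from \<open>w\<close> to
    \<open>v\<close>, whereas \<open>TP\<close> runs from \<open>u\<close> to a constant
    edge.\<close>
  have T: "square X T e e (i (Suc 0) w) (i (Suc 0) v)" using z(3) by (simp add: shell_def T_def)
  have fT: "f (Suc (Suc 0)) T = P" using map_bd[OF f z(1), of 2 False] z(2) W2 by (simp add: T_def)
  \<comment> \<open>\<open>V\<close> is \<open>P(max(x1, x2), x3)\<close>: its faces at
    \<open>x1 = 0\<close> and \<open>x2 = 0\<close> are both \<open>P\<close>, and all others are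
    constant.\<close>
  define V where "V = act Y (Suc (Suc (Suc 0))) (Suc (Suc 0)) (conn (Suc (Suc 0)) (Suc 0) False) P"
  have mor: "cube_mor (Suc (Suc (Suc 0))) (Suc (Suc 0)) (conn (Suc (Suc 0)) (Suc 0) False)"
    by (rule cube_mor_conn) auto
  have PY: "P \<in> cells Y (Suc (Suc 0))" using P by (simp add: square_def)
  have VY: "V \<in> cells Y (Suc (Suc (Suc 0)))" unfolding V_def by (rule act_cells[OF Y mor PY])
  have V12: "bd Y (Suc (Suc 0)) j False V = P" if "j = Suc 0 \<or> j = 2" for j
  proof -
    have "compose (vertices (Suc (Suc 0))) (conn (Suc (Suc 0)) (Suc 0) False) (face (Suc (Suc 0)) j False) = idm (Suc (Suc 0))"
      by (rule vertices_ext[where m = "Suc (Suc 0)"])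
        (use that in \<open>auto simp: compose_app face_app conn_app idm_app length_Suc_conv\<close>)
    then show ?thesis using that by (auto simp: V_def bd_act[OF Y mor PY] act_idm[OF Y PY])
  qed
  have act_bd: "act Y (Suc (Suc 0)) (Suc (Suc 0)) (compose (vertices (Suc (Suc 0))) (face (Suc 0) j b) \<phi>) P = pt Y y (Suc (Suc 0))"
    if "cube_mor (Suc (Suc 0)) (Suc 0) \<phi>" "j = Suc 0 \<or> j = 2" for j b \<phi>
  proof -
    have "bd Y (Suc 0) j b P = pt Y y (Suc 0)" using P that(2) by (cases b) (auto simp: square_def)
    then have "act Y (Suc (Suc 0)) (Suc 0) \<phi> (act Y (Suc 0) (Suc (Suc 0)) (face (Suc 0) j b) P) = pt Y y (Suc (Suc 0))"
      using act_pt[OF Y y that(1)] by (simp add: bd_def)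
    moreover have "cube_mor (Suc 0) (Suc (Suc 0)) (face (Suc 0) j b)" using that(2) by (intro cube_mor_face) auto
    ultimately show ?thesis using act_compose[OF Y that(1) _ PY] by simp
  qed
  have V1: "bd Y (Suc (Suc 0)) j True V = pt Y y (Suc (Suc 0))" if "j = Suc 0 \<or> j = 2" for j
  proof -
    have "compose (vertices (Suc (Suc 0))) (conn (Suc (Suc 0)) (Suc 0) False) (face (Suc (Suc 0)) j True)
        = compose (vertices (Suc (Suc 0))) (face (Suc 0) (Suc 0) True) (degen (Suc 0) (Suc 0))"
      by (rule vertices_ext[where m = "Suc (Suc 0)"])
        (use that in \<open>auto simp: compose_app face_app conn_app degen_app length_Suc_conv\<close>)
    moreover have "cube_mor (Suc (Suc 0)) (Suc 0) (degen (Suc 0) (Suc 0))" by (rule cube_mor_degen) auto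
    ultimately show ?thesis using that act_bd by (auto simp: V_def bd_act[OF Y mor PY])
  qed
  have V3: "bd Y (Suc (Suc 0)) 3 b V = pt Y y (Suc (Suc 0))" for b
  proof -
    have "compose (vertices (Suc (Suc 0))) (conn (Suc (Suc 0)) (Suc 0) False) (face (Suc (Suc 0)) 3 b)
        = compose (vertices (Suc (Suc 0))) (face (Suc 0) 2 b) (conn (Suc 0) (Suc 0) False)"
      by (rule vertices_ext[where m = "Suc (Suc 0)"])
        (auto simp: compose_app face_app conn_app length_Suc_conv numeral_2_eq_2)
    moreover have "cube_mor (Suc (Suc 0)) (Suc 0) (conn (Suc 0) (Suc 0) False)" by (rule cube_mor_conn) auto
    ultimately show ?thesis using act_bd by (simp add: V_def bd_act[OF Y mor PY])
  qed
  have v: "edge X (i (Suc 0) v) x x" using edge_map[OF i uvw(2)] by (simp add: ia)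
  \<comment> \<open>\<open>S\<close> lies over a constant square because \<open>v\<close> is in the
    fiber; it closes the second box at \<open>x2 = 1\<close> and at \<open>x3 = 1\<close>.\<close>
  define S where "S = act X (Suc (Suc 0)) (Suc 0) (degen (Suc 0) 2) (i (Suc 0) v)"
  have S: "square X S e e (i (Suc 0) v) (i (Suc 0) v)"
    using square_degen_2[OF X v] by (simp add: S_def e_def)
  have v1: "v \<in> cells A (Suc 0)" using uvw by (simp add: edge_def)
  have fS: "f (Suc (Suc 0)) S = pt Y y (Suc (Suc 0))"
  proof -
    have "cube_mor (Suc (Suc 0)) (Suc 0) (degen (Suc 0) 2)" by (rule cube_mor_degen) auto
    then show ?thesis
      using act_pt[OF Y y] map_act[OF f _ map_cells[OF i v1]] fi[OF v1] by (simp add: S_def)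
  qed
  define G where "G j \<eta> = (if j = Suc 0 then if \<eta> then K else TP else if j = 2 then if \<eta> then S else T else S)"
    for j :: nat and \<eta>
  define ea where "ea \<beta> \<gamma> = (if \<beta> \<or> \<gamma> then i (Suc 0) v else i (Suc 0) w)" for \<beta> \<gamma>
  define eb where "eb \<beta> \<gamma> = (if \<beta> \<or> \<gamma> then e else i (Suc 0) u)" for \<beta> \<gamma>
  \<comment> \<open>The open face is at \<open>x3 = 0\<close>, over a constant face of
    \<open>V\<close>, so it comes from \<open>A\<close>. Its left, bottom and top edges are the
    images of \<open>u\<close>, \<open>w\<close> and \<open>v\<close>; the right one is
    constant.\<close>
  obtain q where q: "q \<in> cells X (Suc (Suc (Suc 0)))" "f (Suc (Suc (Suc 0))) q = V"
    "shell X (\<lambda>j \<eta>. bd X (Suc (Suc 0)) j \<eta> q) ea eb (\<lambda>_ _. e) 3 False"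
  proof (rule fill_cube[OF X fill VY, of 3 False G ea eb "\<lambda>_ _. e"], goal_cases)
    case (2 j \<eta>)
    then show ?case using K TP T S fK fT fS V1 V12 V3
      by (cases \<eta>) (auto simp: shell_def G_def ea_def eb_def e_def)
  qed auto
  have "f (Suc (Suc 0)) (bd X (Suc (Suc 0)) 3 False q) = pt Y y (Suc (Suc 0))"
    using map_bd[OF f q(1), of 3 False] q(2) V3 by simp
  moreover have "e = i (Suc 0) (pt A a (Suc 0))" using map_pt[OF i a] by (simp add: ia e_def)
  ultimately show ?thesis
    using q(3) uvw pt_cells[OF A a]
    by (intro square_fiber[of "bd X (Suc (Suc 0)) 3 False q"]) (auto simp: shell_def ea_def eb_def edge_def)
qed

end

text \<open>The connecting map of the looped sequence takes values in classes of loops in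
  \<open>A\<close>, that is, in \<open>pi_1 A\<close>. One product square in the loop object of
  \<open>Y\<close> and three transgressions are the data for \<open>transgress_mult\<close>.\<close>

lemma connecting_hom:
  assumes "fiber_sequence A a X x Y y i f"
  shows "connecting (Loop A a) (Loop X x) (pt X x (Suc 0)) (Loop Y y) (pt Y y (Suc 0)) (loop_map i) (loop_map f)
    \<in> hom (pi1_group (Loop Y y, pt Y y (Suc 0))) (pi1_group (A, a))"
proof -
  interpret fiber_sequence A a X x Y y i f by fact
  interpret L: fiber_sequence "Loop A a" "pt A a (Suc 0)" "Loop X x" "pt X x (Suc 0)" "Loop Y y" "pt Y y (Suc 0)"
    "loop_map i" "loop_map f" by (rule fiber_sequence_Loop)
  have carrier: "carrier (pi1_group (Loop Y y, pt Y y (Suc 0))) = pi0 (Loop (Loop Y y) (pt Y y (Suc 0)))"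
    "carrier (pi1_group (A, a)) = pi0 (Loop A a)"
    by (simp_all add: pi1_group_def pi_set_def Loop_def)
  show ?thesis
  proof (rule homI)
    fix C assume "C \<in> carrier (pi1_group (Loop Y y, pt Y y (Suc 0)))"
    then show "L.delta C \<in> carrier (pi1_group (A, a))" using L.delta_mem by (simp add: carrier)
  next
    fix C D assume "C \<in> carrier (pi1_group (Loop Y y, pt Y y (Suc 0)))" "D \<in> carrier (pi1_group (Loop Y y, pt Y y (Suc 0)))"
    then obtain P Q where P: "edge (Loop Y y) P (pt Y y (Suc 0)) (pt Y y (Suc 0))" "C = L.cls P"
      and Q: "edge (Loop Y y) Q (pt Y y (Suc 0)) (pt Y y (Suc 0))" "D = L.cls Q"
      unfolding carrier by (metis L.loop_classE)
    have ptY: "pt (Loop Y y) (pt Y y (Suc 0)) (Suc 0) = pt Y y (Suc (Suc 0))" by (rule pt_Loop[OF Y y])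
    obtain R where R: "edge (Loop Y y) R (pt Y y (Suc 0)) (pt Y y (Suc 0))"
      and sq: "Sq (Loop Y y) P (pt (Loop Y y) (pt Y y (Suc 0)) (Suc 0)) R Q"
      using Sq_product[OF L.kan_Y P(1) Q(1)] .
    obtain W where W: "square (Loop Y y) W P (pt Y y (Suc (Suc 0))) R Q"
      using sq by (auto simp: Sq_def ptY)
    obtain u v w where uvw: "L.trg P u" "L.trg Q v" "L.trg R w"
      using L.trg_ex P(1) Q(1) R by metis
    then have uvw_A: "edge A u a a" "edge A v a a" "edge A w a a"
      by (auto simp: transgress_def Loop_edge[OF A a])
    obtain TP TQ TR where
      "edge (Loop X x) TP (i (Suc 0) u) (pt X x (Suc 0))" "f (Suc (Suc 0)) TP = P"
      "edge (Loop X x) TQ (i (Suc 0) v) (pt X x (Suc 0))" "f (Suc (Suc 0)) TQ = Q"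
      "edge (Loop X x) TR (i (Suc 0) w) (pt X x (Suc 0))" "f (Suc (Suc 0)) TR = R"
      using uvw by (auto simp: transgress_def loop_map_def)
    then have "Sq A u (pt A a (Suc 0)) w v"
      using W P(1) uvw_A by (intro transgress_mult[of W P R Q TP u TQ v TR w]) (simp_all add: edge_Loop_square)
    from pi1_mult_class[OF kan_A a uvw_A(1,2) this]
    have "pi1_mult (A, a) (L.delta C) (L.delta D) = L.delta (L.cls R)"
      using L.delta_class[OF P(1) uvw(1)] L.delta_class[OF Q(1) uvw(2)] L.delta_class[OF R uvw(3)] P(2) Q(2) by simp
    moreover have "pi1_mult (Loop Y y, pt Y y (Suc 0)) C D = L.cls R"
      using pi1_mult_class[OF L.kan_Y L.y P(1) Q(1) sq] P(2) Q(2) by simp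
    ultimately show "L.delta (C \<otimes>\<^bsub>pi1_group (Loop Y y, pt Y y (Suc 0))\<^esub> D)
      = L.delta C \<otimes>\<^bsub>pi1_group (A, a)\<^esub> L.delta D"
      by (simp add: pi1_group_def)
  qed
qed

text \<open>Cubical maps send product squares to product squares.\<close>

lemma pi1_map_hom:
  assumes X: "kan X" and Y: "kan Y" and f: "cubical_map X Y f" and x: "x \<in> cells X 0" and fx: "f 0 x = y"
  shows "pi0_map (Loop Y y) (loop_map f) \<in> hom (pi1_group (X, x)) (pi1_group (Y, y))"
proof -
  have cX: "cubical_set X" and cY: "cubical_set Y" using X Y by (auto simp: kan_def)
  have y: "y \<in> cells Y 0" using map_cells[OF f x] fx by simp
  have carrier: "carrier (pi1_group (X, x)) = pi0 (Loop X x)" "carrier (pi1_group (Y, y)) = pi0 (Loop Y y)"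
    by (simp_all add: pi1_group_def pi_set_def Loop_def)
  have f_edge: "edge Y (f (Suc 0) g) y y" if "edge X g x x" for g
    using edge_map[OF f that] fx by simp
  have f_class: "pi0_map (Loop Y y) (loop_map f) (pi0_class (Loop X x) 0 g) = pi0_class (Loop Y y) 0 (f (Suc 0) g)"
    if "edge X g x x" for g
    using pi0_map_class[OF cubical_set_Loop[OF cX x] cubical_map_Loop[OF f x], of g 0] that
    by (simp add: Loop_edge[OF cX x] fx loop_map_def)
  have classE: "\<exists>g. edge X g x x \<and> C = pi0_class (Loop X x) 0 g" if "C \<in> pi0 (Loop X x)" for C
    using that pi0_eq_image[OF cubical_set_Loop[OF cX x]] Loop_edge[OF cX x] by auto
  show ?thesis
  proof (rule homI)
    fix C assume "C \<in> carrier (pi1_group (X, x))"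
    then obtain g where "edge X g x x" "C = pi0_class (Loop X x) 0 g" using classE carrier by blast
    then show "pi0_map (Loop Y y) (loop_map f) C \<in> carrier (pi1_group (Y, y))"
      using f_class f_edge pi0_eq_image[OF cubical_set_Loop[OF cY y]] Loop_edge[OF cY y] by (simp add: carrier)
  next
    fix C D assume "C \<in> carrier (pi1_group (X, x))" "D \<in> carrier (pi1_group (X, x))"
    then obtain g h where g: "edge X g x x" "C = pi0_class (Loop X x) 0 g"
      and h: "edge X h x x" "D = pi0_class (Loop X x) 0 h"
      using classE carrier by blast
    obtain k where k: "edge X k x x" "Sq X g (pt X x (Suc 0)) k h" using Sq_product[OF X g(1) h(1)] .
    then have "Sq Y (f (Suc 0) g) (pt Y y (Suc 0)) (f (Suc 0) k) (f (Suc 0) h)"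
      using square_map[OF f] map_pt[OF f x] fx unfolding Sq_def by metis
    from pi1_mult_class[OF Y y f_edge[OF g(1)] f_edge[OF h(1)] this] pi1_mult_class[OF X x g(1) h(1) k(2)]
    show "pi0_map (Loop Y y) (loop_map f) (C \<otimes>\<^bsub>pi1_group (X, x)\<^esub> D)
      = pi0_map (Loop Y y) (loop_map f) C \<otimes>\<^bsub>pi1_group (Y, y)\<^esub> pi0_map (Loop Y y) (loop_map f) D"
      using f_class g h k by (simp add: pi1_group_def)
  qed
qed

section \<open>From the pullback to the long exact sequence\<close>

lemma fiber_sequence_pullback:
  assumes "kan X" "kan Y" "y \<in> cells Y 0" "cubical_map X Y f" "f 0 x = y"
    and pb: "is_pullback A X (cube 0) Y i terminal_map f (point Y y)"
    and "a \<in> cells A 0" "i 0 a = x" and fill: "box_filling X Y f"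
  shows "fiber_sequence A a X x Y y i f"
proof -
  have fi: "f n (i n w) = pt Y y n" if "w \<in> cells A n" for n w
    using pb that by (simp add: is_pullback_def terminal_map_def point_def pt_def)
  \<comment> \<open>The projection to \<open>cube 0\<close> has only one possible value, so the
    universal property becomes one of \<open>i\<close> alone.\<close>
  have ex1: "\<exists>!w. w \<in> cells A n \<and> i n w = z" if "z \<in> cells X n" "f n z = pt Y y n" for n z
  proof -
    have "bang n \<in> cells (cube 0) n" by (simp add: cube_def cube_mor_bang)
    with pb that have "\<exists>!w. w \<in> cells A n \<and> i n w = z \<and> terminal_map n w = bang n"
      unfolding is_pullback_def point_def pt_def by blast
    then show ?thesis by (simp add: terminal_map_def)
  qed
  show ?thesis
  proof
    fix n w w' assume "w \<in> cells A n" "w' \<in> cells A n" "i n w = i n w'"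
    moreover from this(1) have "i n w \<in> cells X n" using pb map_cells[of A X i] by (simp add: is_pullback_def)
    ultimately show "w = w'" using ex1[of "i n w" n] fi by metis
  next
    fix n z assume "z \<in> cells X n" "f n z = pt Y y n"
    then show "\<exists>w\<in>cells A n. i n w = z" using ex1 by blast
  qed (use assms fi in \<open>simp_all add: is_pullback_def\<close>)
qed

lemma fiber_sequence_funpow:
  assumes "fiber_sequence A a X x Y y i f"
  shows "fiber_sequence (fst ((loop ^^ n) (A, a))) (snd ((loop ^^ n) (A, a)))
    (fst ((loop ^^ n) (X, x))) (snd ((loop ^^ n) (X, x))) (fst ((loop ^^ n) (Y, y))) (snd ((loop ^^ n) (Y, y)))
    ((loop_map ^^ n) i) ((loop_map ^^ n) f)"
proof (induction n)
  case 0
  show ?case using assms by simp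
next
  case (Suc n)
  interpret fiber_sequence "fst ((loop ^^ n) (A, a))" "snd ((loop ^^ n) (A, a))"
    "fst ((loop ^^ n) (X, x))" "snd ((loop ^^ n) (X, x))" "fst ((loop ^^ n) (Y, y))" "snd ((loop ^^ n) (Y, y))"
    "(loop_map ^^ n) i" "(loop_map ^^ n) f" by (rule Suc)
  show ?case
    using fiber_sequence_Loop loop_eq[OF A, of "snd ((loop ^^ n) (A, a))"]
      loop_eq[OF X, of "snd ((loop ^^ n) (X, x))"] loop_eq[OF Y, of "snd ((loop ^^ n) (Y, y))"]
    by simp
qed

theorem corollary4p6:
  fixes X :: "'a cset" and Y :: "'b cset" and A :: "'c cset"
    and x :: 'a and y :: 'b and a :: 'c
    and f :: "nat \<Rightarrow> 'a \<Rightarrow> 'b" and i :: "nat \<Rightarrow> 'c \<Rightarrow> 'a"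
  assumes "kan_complex X" and "x \<in> cells X 0"
    and "kan_complex Y" and "y \<in> cells Y 0"
    and "cubical_map X Y f" and "f 0 x = y"
    and "is_pullback A X (cube 0) Y i terminal_map f (point Y y)"
    and "a \<in> cells A 0" and "i 0 a = x"
    and "kan_fibration X Y f"
  shows
    "(\<forall>n\<ge>1. group (pi_group n (A, a)) \<and> group (pi_group n (X, x)) \<and> group (pi_group n (Y, y)) \<and>
        pi_map n (X, x) i \<in> hom (pi_group n (A, a)) (pi_group n (X, x)) \<and>
        pi_map n (Y, y) f \<in> hom (pi_group n (X, x)) (pi_group n (Y, y))) \<and>
     pointed_map (pi_set 0 (A, a)) (pi_base 0 (A, a)) (pi_set 0 (X, x)) (pi_base 0 (X, x))
       (pi_map 0 (X, x) i) \<and>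
     pointed_map (pi_set 0 (X, x)) (pi_base 0 (X, x)) (pi_set 0 (Y, y)) (pi_base 0 (Y, y))
       (pi_map 0 (Y, y) f) \<and>
     (\<exists>\<delta> :: nat \<Rightarrow> (nat \<times> 'b) set \<Rightarrow> (nat \<times> 'c) set.
        (\<forall>n\<ge>1. \<delta> n \<in> hom (pi_group (Suc n) (Y, y)) (pi_group n (A, a))) \<and>
        pointed_map (pi_set 1 (Y, y)) (pi_base 1 (Y, y)) (pi_set 0 (A, a)) (pi_base 0 (A, a)) (\<delta> 0) \<and>
        (\<forall>n. exact_at (pi_set (Suc n) (X, x)) (pi_map (Suc n) (Y, y) f)
               (pi_set (Suc n) (Y, y)) (\<delta> n) (pi_base n (A, a))) \<and>
        (\<forall>n. exact_at (pi_set (Suc n) (Y, y)) (\<delta> n)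
               (pi_set n (A, a)) (pi_map n (X, x) i) (pi_base n (X, x))) \<and>
        (\<forall>n. exact_at (pi_set n (A, a)) (pi_map n (X, x) i)
               (pi_set n (X, x)) (pi_map n (Y, y) f) (pi_base n (Y, y))))"
proof -
  define A' a' where "A' n = fst ((loop ^^ n) (A, a))" and "a' n = snd ((loop ^^ n) (A, a))" for n
  define X' x' where "X' n = fst ((loop ^^ n) (X, x))" and "x' n = snd ((loop ^^ n) (X, x))" for n
  define Y' y' where "Y' n = fst ((loop ^^ n) (Y, y))" and "y' n = snd ((loop ^^ n) (Y, y))" for n
  define i' f' where "i' n = (loop_map ^^ n) i" and "f' n = (loop_map ^^ n) f" for n
  note defs = A'_def a'_def X'_def x'_def Y'_def y'_def i'_def f'_def
  have X: "kan X" and Y: "kan Y" using assms by (auto intro: kan_complex_kan)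
  have "box_filling X Y f"
    using assms by (intro kan_fibration_box_filling) (auto simp: kan_complex_def)
  with assms X Y have "fiber_sequence A a X x Y y i f" by (intro fiber_sequence_pullback)
  then have seq: "fiber_sequence (A' n) (a' n) (X' n) (x' n) (Y' n) (y' n) (i' n) (f' n)" for n
    unfolding defs by (rule fiber_sequence_funpow)
  define \<delta> where "\<delta> n = connecting (A' n) (X' n) (x' n) (Y' n) (y' n) (i' n) (f' n)" for n
  have pairs: "(loop ^^ n) (A, a) = (A' n, a' n)" "(loop ^^ n) (X, x) = (X' n, x' n)" "(loop ^^ n) (Y, y) = (Y' n, y' n)" for n
    by (simp_all add: defs)
  have Suc_fst: "A' (Suc n) = Loop (A' n) (a' n)" "X' (Suc n) = Loop (X' n) (x' n)" "Y' (Suc n) = Loop (Y' n) (y' n)" for n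
    by (simp_all add: defs Loop_def)
  have Suc_snd: "a' (Suc n) = pt (A' n) (a' n) (Suc 0)" "x' (Suc n) = pt (X' n) (x' n) (Suc 0)"
    "y' (Suc n) = pt (Y' n) (y' n) (Suc 0)" for n
  proof -
    interpret fiber_sequence "A' n" "a' n" "X' n" "x' n" "Y' n" "y' n" "i' n" "f' n" by (rule seq)
    show "a' (Suc n) = pt (A' n) (a' n) (Suc 0)" "x' (Suc n) = pt (X' n) (x' n) (Suc 0)"
      "y' (Suc n) = pt (Y' n) (y' n) (Suc 0)"
      using loop_eq[OF A, of "a' n"] loop_eq[OF X, of "x' n"] loop_eq[OF Y, of "y' n"]
      by (simp_all add: defs)
  qed
  have Suc_map: "i' (Suc n) = loop_map (i' n)" "f' (Suc n) = loop_map (f' n)" for n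
    by (simp_all add: defs)
  have sets: "pi_set n (A, a) = pi0 (A' n)" "pi_set n (X, x) = pi0 (X' n)" "pi_set n (Y, y) = pi0 (Y' n)" for n
    by (simp_all add: pi_set_def pairs)
  have bases: "pi_base n (A, a) = pi0_class (A' n) 0 (a' n)" "pi_base n (X, x) = pi0_class (X' n) 0 (x' n)"
    "pi_base n (Y, y) = pi0_class (Y' n) 0 (y' n)" for n
    by (simp_all add: pi_base_def pairs)
  have maps: "pi_map n (X, x) i = pi0_map (X' n) (i' n)" "pi_map n (Y, y) f = pi0_map (Y' n) (f' n)" for n
    by (simp_all add: pi_map_def defs)
  have groups: "pi_group (Suc n) (A, a) = pi1_group (A' n, a' n)" "pi_group (Suc n) (X, x) = pi1_group (X' n, x' n)"
    "pi_group (Suc n) (Y, y) = pi1_group (Y' n, y' n)" for n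
    by (simp_all add: pi_group_def pairs)
  have level: "group (pi_group n (A, a)) \<and> group (pi_group n (X, x)) \<and> group (pi_group n (Y, y)) \<and>
      pi_map n (X, x) i \<in> hom (pi_group n (A, a)) (pi_group n (X, x)) \<and>
      pi_map n (Y, y) f \<in> hom (pi_group n (X, x)) (pi_group n (Y, y)) \<and>
      \<delta> n \<in> hom (pi_group (Suc n) (Y, y)) (pi_group n (A, a))" if n1: "n \<ge> 1" for n
  proof -
    \<comment> \<open>Index shift: \<open>pi_group n\<close> is the fundamental group of the loop
      object number \<open>n - 1\<close>, while \<open>\<delta> n\<close> is the connecting map
      after one more looping.\<close>
    obtain m where n: "n = Suc m" using n1 by (cases n) auto
    interpret fiber_sequence "A' m" "a' m" "X' m" "x' m" "Y' m" "y' m" "i' m" "f' m" by (rule seq)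
    show ?thesis
      unfolding n groups maps \<delta>_def Suc_fst Suc_snd Suc_map
      by (intro conjI group_pi1 kan_A kan_X kan_Y a x y pi1_map_hom i f ia fx connecting_hom[OF seq])
  qed
  have exact: "exact_at (pi_set (Suc n) (X, x)) (pi_map (Suc n) (Y, y) f) (pi_set (Suc n) (Y, y)) (\<delta> n) (pi_base n (A, a))"
    "exact_at (pi_set (Suc n) (Y, y)) (\<delta> n) (pi_set n (A, a)) (pi_map n (X, x) i) (pi_base n (X, x))"
    "exact_at (pi_set n (A, a)) (pi_map n (X, x) i) (pi_set n (X, x)) (pi_map n (Y, y) f) (pi_base n (Y, y))" for n
  proof -
    interpret fiber_sequence "A' n" "a' n" "X' n" "x' n" "Y' n" "y' n" "i' n" "f' n" by (rule seq)
    show "exact_at (pi_set (Suc n) (X, x)) (pi_map (Suc n) (Y, y) f) (pi_set (Suc n) (Y, y)) (\<delta> n) (pi_base n (A, a))"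
      "exact_at (pi_set (Suc n) (Y, y)) (\<delta> n) (pi_set n (A, a)) (pi_map n (X, x) i) (pi_base n (X, x))"
      "exact_at (pi_set n (A, a)) (pi_map n (X, x) i) (pi_set n (X, x)) (pi_map n (Y, y) f) (pi_base n (Y, y))"
      unfolding sets maps bases Suc_fst Suc_map \<delta>_def
      by (rule exact_pi1_Y exact_pi0_A exact_pi0_X)+
  qed
  interpret fiber_sequence A a X x Y y i f
    using seq[of 0] by (simp add: defs)
  have "pointed_map (pi_set 0 (A, a)) (pi_base 0 (A, a)) (pi_set 0 (X, x)) (pi_base 0 (X, x)) (pi_map 0 (X, x) i)"
    "pointed_map (pi_set 0 (X, x)) (pi_base 0 (X, x)) (pi_set 0 (Y, y)) (pi_base 0 (Y, y)) (pi_map 0 (Y, y) f)"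
    using pi0_map_class[OF A i] pi0_map_class[OF X f] map_cells[OF i] map_cells[OF f] a x ia fx
    by (auto simp: pointed_map_def pi_set_def pi_base_def pi_map_def pi0_eq_image[OF A] pi0_eq_image[OF X] pi0_eq_image[OF Y])
  moreover have "pointed_map (pi_set 1 (Y, y)) (pi_base 1 (Y, y)) (pi_set 0 (A, a)) (pi_base 0 (A, a)) (\<delta> 0)"
    using delta_mem delta_base loop_eq[OF Y]
    by (auto simp: pointed_map_def pi_set_def pi_base_def \<delta>_def defs)
  ultimately show ?thesis using level exact by blast
qed

end
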